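(* Let $L/K$ be a finite extension with maximal separable subextension $L_S/K$, and let $A=\mathrm{Aut}(L/K)$ with fixed field $L^A$. The following are equivalent: (a) $L/K$ is normal; (b) $s_K(L)=1$; (c) $r_K(L)=[L_S:K]$; (d) $l_K(L)=[L:K]$; (e) $[L:L_S]=[L^A:K]$; (f) $L^A/K$ is purely inseparable.
   Context: $K$ is any field (not necessarily perfect) with a fixed algebraic closure $\bar K$; all extensions are finite and contained in $\bar K$. $r_K(L)=|\mathrm{Aut}(L/K)|$; $s_K(L)$ is the number of distinct subfields of $\bar K$ isomorphic to $L$ over $K$; $l_K(L)=[L:L_S]\cdot r_K(L)$. The trivial extension $K/K$ counts as purely inseparable. *)

theory Defs
  imports "HOL-Algebra.Algebraic_Closure"
begin

text \<open>
  Extensions live inside one ambient field \<open>R\<close>; in the main statement \<open>R\<close> is an algebraic closure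
  of \<open>K\<close>. The degree of an extension of \<open>K\<close> by \<open>L\<close> is \<open>dim K L\<close>.
\<close>

definition fixed_field :: "'a set \<Rightarrow> ('a \<Rightarrow> 'a) set \<Rightarrow> 'a set"
  where "fixed_field L A = { x \<in> L. \<forall>\<phi> \<in> A. \<phi> x = x }"

context ring
begin

text \<open>\<open>splitted\<close> is taken in the ring \<open>L\<close> itself: \<open>splitted_on L\<close> is unsuitable because it is
  built from \<open>mset_set L\<close>, which is empty for infinite \<open>L\<close> and forgets multiplicities.\<close>

definition normal_extension :: "'a set \<Rightarrow> 'a set \<Rightarrow> bool"
  where "normal_extension K L \<longleftrightarrow>
           (\<forall>x \<in> L. (algebraic over K) x) \<and>
           (\<forall>p \<in> carrier (K[X]). pirreducible K p \<longrightarrow> (\<exists>x \<in> L. eval p x = \<zero>) \<longrightarrow>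
              ring.splitted (R \<lparr> carrier := L \<rparr>) p)"

text \<open>Over an algebraic closure this says that the minimal polynomial has only simple roots.\<close>

definition separable_element :: "'a set \<Rightarrow> 'a \<Rightarrow> bool"
  where "separable_element K x \<longleftrightarrow>
           (algebraic over K) x \<and> (\<forall>y \<in> carrier R. alg_mult (Irr K x) y \<le> 1)"

definition separable_extension :: "'a set \<Rightarrow> 'a set \<Rightarrow> bool"
  where "separable_extension K L \<longleftrightarrow> (\<forall>x \<in> L. separable_element K x)"

definition purely_inseparable_extension :: "'a set \<Rightarrow> 'a set \<Rightarrow> bool"
  where "purely_inseparable_extension K L \<longleftrightarrow>
           (\<forall>x \<in> L. (algebraic over K) x) \<and> (\<forall>x \<in> L - K. \<not> separable_element K x)"

definition max_separable_subextension :: "'a set \<Rightarrow> 'a set \<Rightarrow> 'a set"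
  where "max_separable_subextension K L =
           (GREATEST E. subfield E R \<and> K \<subseteq> E \<and> E \<subseteq> L \<and> separable_extension K E)"

text \<open>Members of \<open>ring_iso\<close> are total functions on the type, with arbitrary values off the domain;
  extensionality makes each isomorphism count once.\<close>

definition isos_over :: "'a set \<Rightarrow> 'a set \<Rightarrow> 'a set \<Rightarrow> ('a \<Rightarrow> 'a) set"
  where "isos_over K E F =
           { \<phi> \<in> ring_iso (R \<lparr> carrier := E \<rparr>) (R \<lparr> carrier := F \<rparr>).
               \<phi> \<in> extensional E \<and> (\<forall>k \<in> K. \<phi> k = k) }"

definition auts_over :: "'a set \<Rightarrow> 'a set \<Rightarrow> ('a \<Rightarrow> 'a) set"
  where "auts_over K L = isos_over K L L"

definition r_count :: "'a set \<Rightarrow> 'a set \<Rightarrow> nat"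
  where "r_count K L = card (auts_over K L)"

definition s_count :: "'a set \<Rightarrow> 'a set \<Rightarrow> nat"
  where "s_count K L = card { E. subfield E R \<and> K \<subseteq> E \<and> isos_over K L E \<noteq> {} }"

definition l_count :: "'a set \<Rightarrow> 'a set \<Rightarrow> nat"
  where "l_count K L = dim (max_separable_subextension K L) L * r_count K L"

end

end

theory Submission
  imports Defs "HOL-Computational_Algebra.Primes"
begin

text \<open>
  Let \<open>A\<close> be the automorphism group of \<open>L/K\<close> and \<open>T = L\<^sub>S \<inter> L\<^sup>A\<close>. Some \<open>p\<close>-power of every element of
  \<open>L\<close> lies in \<open>L\<^sub>S\<close>, so \<open>A\<close> acts faithfully on \<open>L\<^sub>S\<close> and Artin's theorem gives both \<open>|A| = [L : L\<^sup>A]\<close>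
  and \<open>|A| = [L\<^sub>S : T]\<close>. Hence (c), (d), (e) and (f) all say that \<open>T = K\<close>. If \<open>T = K\<close>, every
  \<open>K\<close>-embedding of \<open>L\<close> fixes \<open>L\<^sup>A\<close>, and by Dedekind's lemma there are at most \<open>[L : L\<^sup>A] = |A|\<close> such
  embeddings, so all of them are automorphisms and \<open>L/K\<close> is normal. Conversely, in a normal extension
  an element of \<open>L\<^sub>S\<close> outside \<open>K\<close> has a second conjugate, which some automorphism reaches.

  Separability is handled through the criterion that an algebraic \<open>x\<close> is separable over \<open>K\<close> iff
  \<open>x \<in> K(x\<^sup>p)\<close>, with \<open>p\<close> the exponential characteristic.
\<close>

section \<open>Exponential characteristic\<close>

text \<open>Inseparability blocks plain root counting: distinct roots see only the separable part,
  and \<open>L\<^sup>A\<close> need not lie in \<open>L\<^sub>S\<close>. The field \<open>T\<close>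
  ties the towers through \<open>L\<^sup>A\<close> and through \<open>L\<^sub>S\<close> together.
  From \<open>[L : K] = [L\<^sup>A : K] |A| = [L\<^sub>S : K] [L : L\<^sub>S]\<close> both (d) and
  (e) reduce to \<open>|A| = [L\<^sub>S : K]\<close>, and \<open>|A| = [L\<^sub>S : T]\<close> turns
  this into \<open>[T : K] = 1\<close>. As \<open>T\<close> is the set of separable elements of
  \<open>L\<^sup>A\<close>, (f) says the same. Condition (b) is tied to normality directly: the
  subfields it counts are the images of \<open>L\<close> under its embeddings. The criterion
  \<open>x \<in> K(x\<^sup>p)\<close> makes separability a matter of linear algebra. Since
  \<open>x \<mapsto> x\<^sup>p\<close> is additive and maps \<open>K\<close> into itself, it carries
  spanning lists to spanning lists of the field generated by \<open>p\<close>-th powers, so closure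
  of the separable elements under the field operations follows from dimensions alone, without
  primitive elements or a count of embeddings.\<close>

lemma (in cring) binomial_expansion:
  assumes x: "x \<in> carrier R" and y: "y \<in> carrier R"
  shows "(x \<oplus> y) [^] (n::nat) = (\<Oplus>k\<in>{..n}. [(n choose k)] \<cdot> (x [^] k \<otimes> y [^] (n - k)))"
proof (induction n)
  case 0
  show ?case using x y by simp
next
  case (Suc n)
  define t where "t k = [(n choose k)] \<cdot> (x [^] k \<otimes> y [^] (n - k))" for k
  \<comment> \<open>\<open>u\<close> extends \<open>y \<otimes> t\<close> to the index
    \<open>Suc n\<close>, where its binomial coefficient vanishes; Pascal's rule then holds for
    every \<open>k\<close> without a boundary case.\<close>
  define u where "u k = [(n choose k)] \<cdot> (x [^] k \<otimes> y [^] (Suc n - k))" for k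
  have cl [simp]: "t k \<in> carrier R" "u k \<in> carrier R" for k
    using x y by (auto simp: t_def u_def)
  have ut: "u k = y \<otimes> t k" if "k \<le> n" for k
    using x y that by (simp add: u_def t_def Suc_diff_le add_pow_rdistr m_ac)
  have step: "[(Suc n choose Suc k)] \<cdot> (x [^] Suc k \<otimes> y [^] (Suc n - Suc k)) = x \<otimes> t k \<oplus> u (Suc k)" for k
    using x y by (simp add: u_def t_def add.nat_pow_mult add_pow_rdistr m_ac)
  have u0: "u 0 = [(Suc n choose 0)] \<cdot> (x [^] (0::nat) \<otimes> y [^] (Suc n - 0))"
    by (simp add: u_def)
  have "(\<Oplus>k\<in>{..Suc n}. [(Suc n choose k)] \<cdot> (x [^] k \<otimes> y [^] (Suc n - k))) =
          (\<Oplus>k\<in>{..n}. x \<otimes> t k \<oplus> u (Suc k)) \<oplus> u 0"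
    unfolding u0 step[symmetric] using x y by (intro finsum_Suc2) auto
  also have "\<dots> = (\<Oplus>k\<in>{..n}. x \<otimes> t k) \<oplus> ((\<Oplus>k\<in>{..n}. u (Suc k)) \<oplus> u 0)"
    using x by (simp add: finsum_addf a_assoc Pi_def)
  also have "(\<Oplus>k\<in>{..n}. u (Suc k)) \<oplus> u 0 = (\<Oplus>k\<in>{..Suc n}. u k)"
    by (subst finsum_Suc2) auto
  also have "\<dots> = u (Suc n) \<oplus> (\<Oplus>k\<in>{..n}. u k)"
    by (subst finsum_Suc) auto
  also have "u (Suc n) = \<zero>" using x y by (simp add: u_def binomial_eq_0)
  also have "(\<Oplus>k\<in>{..n}. u k) = (\<Oplus>k\<in>{..n}. y \<otimes> t k)"
    using y by (intro finsum_cong') (auto simp: ut)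
  also have "(\<Oplus>k\<in>{..n}. x \<otimes> t k) \<oplus> (\<zero> \<oplus> (\<Oplus>k\<in>{..n}. y \<otimes> t k)) =
               (x \<oplus> y) \<otimes> (\<Oplus>k\<in>{..n}. t k)"
    using x y by (simp add: finsum_rdistr l_distr Pi_def finsum_closed)
  finally show ?case
    using Suc x y by (simp add: t_def[abs_def] m_comm)
qed

text \<open>The value is 1 in characteristic zero, so that \<open>x \<mapsto> x\<^sup>p\<close> is always an injective endomorphism of a
  field and no case distinction on the characteristic is needed.\<close>

definition (in ring) exp_char :: "nat \<Rightarrow> bool"
  where "exp_char p \<longleftrightarrow> p > 0 \<and>
    (\<forall>x \<in> carrier R. \<forall>y \<in> carrier R. (x \<oplus> y) [^] p = x [^] p \<oplus> y [^] p) \<and>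
    (\<forall>i > 0. [i] \<cdot> \<one> = \<zero> \<longrightarrow> p > 1 \<and> p dvd i)"

text \<open>In positive characteristic the witness is the least positive integer that annihilates
  \<open>\<one>\<close>: it is prime because there are no zero divisors, so it divides the inner
  binomial coefficients and only the two outer terms of the expansion survive.\<close>

lemma (in domain) exists_exp_char: "\<exists>p. exp_char p"
proof (cases "\<exists>i > 0. [(i::nat)] \<cdot> \<one> = \<zero>")
  case False
  then have "exp_char 1" unfolding exp_char_def by (simp, blast)
  then show ?thesis ..
next
  case True
  define p where "p = (LEAST i::nat. i > 0 \<and> [i] \<cdot> \<one> = \<zero>)"
  have p: "p > 0" "[p] \<cdot> \<one> = \<zero>"
    using LeastI_ex[of "\<lambda>i::nat. i > 0 \<and> [i] \<cdot> \<one> = \<zero>"] True by (auto simp: p_def)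
  have least: "p \<le> i" if "i > 0" "[i] \<cdot> \<one> = \<zero>" for i :: nat
    unfolding p_def using that by (intro Least_le) auto
  have mult: "[(a * b)] \<cdot> \<one> = ([a] \<cdot> \<one>) \<otimes> ([b] \<cdot> \<one>)" for a b :: nat
    by (simp add: add_pow_ldistr add.nat_pow_pow mult.commute)
  have dvd: "p dvd i" if "[i] \<cdot> \<one> = \<zero>" for i :: nat
  proof -
    have "[i] \<cdot> \<one> = [((i div p) * p)] \<cdot> \<one> \<oplus> [(i mod p)] \<cdot> \<one>"
      by (simp add: add.nat_pow_mult)
    then have "[(i mod p)] \<cdot> \<one> = \<zero>" using that p by (simp add: mult)
    then show ?thesis using least[of "i mod p"] p(1) by (metis gr0I mod_less_divisor not_le mod_0_imp_dvd)
  qed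
  have "p > 1" using p by (cases "p = 1") auto
  have prime: "prime p"
  proof (rule ccontr)
    assume "\<not> prime p"
    then obtain a b where ab: "p = a * b" "a > 1" "b > 1"
      using \<open>p > 1\<close> prime_nat_iff by (metis One_nat_def dvd_def less_one linorder_neqE_nat mult.right_neutral mult_is_0 nat_dvd_1_iff_1 not_less0 p(1) mult.commute)
    then have "[a] \<cdot> \<one> = \<zero> \<or> [b] \<cdot> \<one> = \<zero>" using p(2) mult[of a b] integral by auto
    then show False using least[of a] least[of b] ab by auto
  qed
  have "(x \<oplus> y) [^] p = x [^] p \<oplus> y [^] p" if xy: "x \<in> carrier R" "y \<in> carrier R" for x y
  proof -
    have zero: "[(p choose k)] \<cdot> z = \<zero>" if k: "0 < k" "k < p" and z: "z \<in> carrier R" for k z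
    proof -
      obtain c where "p choose k = p * c" using dvd_choose_prime[of k p] prime k by (auto simp: dvd_def)
      then have "[(p choose k)] \<cdot> \<one> = \<zero>" using p(2) mult[of p c] by simp
      then show ?thesis using z add_pow_ldistr[of \<one> z "p choose k"] by simp
    qed
    obtain m where m: "p = Suc m" using p(1) gr0_implies_Suc by blast
    let ?t = "\<lambda>k. [(p choose k)] \<cdot> (x [^] k \<otimes> y [^] (p - k))"
    have "(x \<oplus> y) [^] p = (\<Oplus>k\<in>{..Suc m}. ?t k)"
      using binomial_expansion[OF xy, of p] m by simp
    also have "\<dots> = (\<Oplus>k\<in>{0,p}. ?t k)"
    proof -
      have "(\<Oplus>k\<in>{..Suc m}. ?t k) = (\<Oplus>k\<in>{0,p}. ?t k)"
        by (rule add.finprod_mono_neutral_cong_right) (use xy m zero in auto)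
      then show ?thesis .
    qed
    also have "\<dots> = x [^] p \<oplus> y [^] p"
      using xy p(1) by (simp add: a_comm)
    finally show ?thesis .
  qed
  then have "exp_char p" unfolding exp_char_def using dvd p \<open>p > 1\<close> by auto
  then show ?thesis ..
qed

section \<open>The theorems of Dedekind and Artin\<close>

text \<open>Gaussian elimination, by induction on the equations. Arbitrary index sets are used
  because homomorphisms index the unknowns in Dedekind's argument and the equations in
  Artin's.\<close>

lemma (in field) exists_nontrivial_solution:
  assumes "finite I" "finite J" "card I < card J"
    and "\<And>i j. i \<in> I \<Longrightarrow> j \<in> J \<Longrightarrow> M i j \<in> carrier R"
  shows "\<exists>c \<in> J \<rightarrow> carrier R. (\<exists>j \<in> J. c j \<noteq> \<zero>) \<and> (\<forall>i \<in> I. (\<Oplus>j\<in>J. c j \<otimes> M i j) = \<zero>)"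
  using assms
proof (induction I arbitrary: J M rule: finite_induct)
  case empty
  then obtain j where "j \<in> J" by (metis card_gt_0_iff card.empty ex_in_conv)
  then show ?case by (intro bexI[of _ "\<lambda>_. \<one>"]) auto
next
  case (insert i I)
  show ?case
  proof (cases "\<forall>j \<in> J. M i j = \<zero>")
    case True
    have "card I < card J" using insert by auto
    then obtain c where c: "c \<in> J \<rightarrow> carrier R" "\<exists>j \<in> J. c j \<noteq> \<zero>"
        "\<forall>i \<in> I. (\<Oplus>j\<in>J. c j \<otimes> M i j) = \<zero>"
      using insert.IH[of J M] insert.prems by auto
    moreover have "(\<Oplus>j\<in>J. c j \<otimes> M i j) = \<zero>"
      using True c(1) by (intro add.finprod_one_eqI) (auto simp: Pi_iff)
    ultimately show ?thesis by auto
  next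
    case False
    then obtain j0 where j0: "j0 \<in> J" "M i j0 \<noteq> \<zero>" by auto
    define J' where "J' = J - {j0}"
    have J: "J = insert j0 J'" "j0 \<notin> J'" "finite J'" using j0 insert.prems(1) by (auto simp: J'_def)
    have Mc: "M k j \<in> carrier R" if "k \<in> insert i I" "j \<in> insert j0 J'" for k j
      using insert.prems(3) that J by auto
    have unit: "M i j0 \<in> Units R" using j0 Mc[of i j0] field_Units by auto
    define a where "a k = M k j0 \<otimes> inv (M i j0)" for k
    have ac: "a k \<in> carrier R" if "k \<in> insert i I" for k using Mc[of k j0] unit that by (auto simp: a_def)
    \<comment> \<open>Row \<open>k\<close> minus the multiple of the pivot row that clears column
      \<open>j0\<close>; the cleared column is dropped by passing to \<open>J'\<close>.\<close>
    define N where "N k j = M k j \<ominus> a k \<otimes> M i j" for k j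
    have Nc: "N k j \<in> carrier R" if "k \<in> I" "j \<in> J'" for k j
      using Mc[of k j] Mc[of i j] ac[of k] that by (auto simp: N_def)
    have "card I < card J'" using insert.prems(2) insert.hyps J by simp
    then obtain c where c: "c \<in> J' \<rightarrow> carrier R" "\<exists>j \<in> J'. c j \<noteq> \<zero>"
        "\<forall>k \<in> I. (\<Oplus>j\<in>J'. c j \<otimes> N k j) = \<zero>"
      using insert.IH[of J' N] J(3) Nc by auto
    define S where "S k = (\<Oplus>j\<in>J'. c j \<otimes> M k j)" for k
    have Sc: "S k \<in> carrier R" if "k \<in> insert i I" for k
      unfolding S_def using c(1) Mc that by (intro finsum_closed) auto
    \<comment> \<open>The value at \<open>j0\<close> is forced by the pivot equation.\<close>
    define d where "d = c(j0 := \<ominus> (S i \<otimes> inv (M i j0)))"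
    have dc: "d \<in> J \<rightarrow> carrier R" using c(1) Sc[of i] unit J by (auto simp: d_def)
    have sum: "(\<Oplus>j\<in>J. d j \<otimes> M k j) = d j0 \<otimes> M k j0 \<oplus> S k" if k: "k \<in> insert i I" for k
    proof -
      have "(\<Oplus>j\<in>J. d j \<otimes> M k j) = d j0 \<otimes> M k j0 \<oplus> (\<Oplus>j\<in>J'. d j \<otimes> M k j)"
        unfolding J(1) using J dc Mc[OF k] by (intro finsum_insert) auto
      also have "(\<Oplus>j\<in>J'. d j \<otimes> M k j) = S k"
        unfolding S_def using J(2) c(1) Mc[OF k] by (intro finsum_cong') (auto simp: d_def)
      finally show ?thesis .
    qed
    have "(\<Oplus>j\<in>J. d j \<otimes> M i j) = \<zero>"
    proof -
      have "d j0 \<otimes> M i j0 = \<ominus> S i"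
        using unit Sc[of i] Mc[of i j0] by (simp add: d_def l_minus m_assoc)
      then show ?thesis using sum[of i] Sc[of i] by (simp add: l_neg)
    qed
    moreover have "(\<Oplus>j\<in>J. d j \<otimes> M k j) = \<zero>" if k: "k \<in> I" for k
    proof -
      have 1: "c j \<otimes> N k j = c j \<otimes> M k j \<oplus> \<ominus> a k \<otimes> (c j \<otimes> M i j)" if "j \<in> J'" for j
      proof -
        have "c j \<in> carrier R" "M k j \<in> carrier R" "M i j \<in> carrier R" "a k \<in> carrier R"
          using c(1) Mc[of k j] Mc[of i j] ac[of k] k that by auto
        then show ?thesis unfolding N_def by algebra
      qed
      have "\<zero> = (\<Oplus>j\<in>J'. c j \<otimes> M k j \<oplus> \<ominus> a k \<otimes> (c j \<otimes> M i j))"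
        using c(1,3) k Nc by (subst finsum_cong'[OF refl _ 1[symmetric]]) auto
      also have "\<dots> = S k \<oplus> (\<Oplus>j\<in>J'. \<ominus> a k \<otimes> (c j \<otimes> M i j))"
        unfolding S_def using c(1) Mc ac k by (intro finsum_addf) (auto simp: Pi_iff)
      also have "(\<Oplus>j\<in>J'. \<ominus> a k \<otimes> (c j \<otimes> M i j)) = \<ominus> a k \<otimes> S i"
        unfolding S_def using c(1) Mc ac k J(3) by (intro finsum_rdistr[symmetric]) (auto simp: Pi_iff)
      finally have 2: "\<zero> = S k \<oplus> \<ominus> a k \<otimes> S i" .
      have "d j0 \<otimes> M k j0 = \<ominus> a k \<otimes> S i"
        using unit Sc[of i] Mc[of k j0] k unfolding d_def a_def by (simp add: l_minus r_minus m_ac)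
      then show ?thesis using sum[of k] 2 k Sc[of i] Sc[of k] ac[of k] by (simp add: a_comm)
    qed
    moreover have "\<exists>j \<in> J. d j \<noteq> \<zero>" using c(2) J by (auto simp: d_def)
    ultimately show ?thesis using dc by (intro bexI[of _ d]) auto
  qed
qed

text \<open>Artin's argument solves a linear system in \<open>E\<close> as a field of its own,
  whereas the resulting relations are read in the ambient ring.\<close>

lemma (in ring) finsum_consistent:
  assumes "subring E R" and "f \<in> A \<rightarrow> E"
  shows "finsum (R \<lparr> carrier := E \<rparr>) f A = finsum R f A"
proof (cases "finite A")
  case False
  interpret E: ring "R \<lparr> carrier := E \<rparr>" using subring_is_ring[OF assms(1)] .
  show ?thesis using False E.finsum_infinite[of A f] finsum_infinite[of A f] by simp
next
  case True
  interpret E: ring "R \<lparr> carrier := E \<rparr>" using subring_is_ring[OF assms(1)] .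
  show ?thesis using True assms(2)
  proof (induction A)
    case empty
    show ?case by simp
  next
    case (insert a A)
    have "f \<in> A \<rightarrow> carrier R" "f a \<in> carrier R" using insert.prems subringE(1)[OF assms(1)] by auto
    then show ?case using insert E.finsum_insert[of A a f] by simp
  qed
qed

lemma (in ring) combine_eq_finsum:
  assumes "length Ks = length Us" "set Ks \<subseteq> carrier R" "set Us \<subseteq> carrier R"
  shows "combine Ks Us = (\<Oplus>i\<in>{..<length Us}. Ks ! i \<otimes> Us ! i)"
  using assms
proof (induction Ks Us rule: list_induct2)
  case Nil
  show ?case by simp
next
  case (Cons k Ks u Us)
  have set: "{..<length (u # Us)} = insert 0 (Suc ` {..<length Us})"
    by (auto simp: lessThan_Suc_eq_insert_0)
  let ?f = "\<lambda>i. (k # Ks) ! i \<otimes> (u # Us) ! i"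
  have f: "?f i \<in> carrier R" if "i < length (u # Us)" for i
    using that Cons by (metis length_Cons m_closed nth_mem subsetD)
  then have "(\<Oplus>i\<in>{..<length (u # Us)}. ?f i) = ?f 0 \<oplus> (\<Oplus>i\<in>Suc ` {..<length Us}. ?f i)"
    unfolding set using f[of 0] by (intro finsum_insert) auto
  also have "(\<Oplus>i\<in>Suc ` {..<length Us}. ?f i) = (\<Oplus>i\<in>{..<length Us}. ?f (Suc i))"
    using f by (intro finsum_reindex) auto
  finally show ?case using Cons by simp
qed

text \<open>The step hands over \<open>P v\<close> but no membership of \<open>v\<close> in the
  span, so applications put a carrier condition into \<open>P\<close> wherever the algebra needs
  one.\<close>

lemma (in ring) Span_induct [consumes 1, case_names zero step]:
  assumes "x \<in> Span K Us" "P \<zero>"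
    and "\<And>k u v. k \<in> K \<Longrightarrow> u \<in> set Us \<Longrightarrow> P v \<Longrightarrow> P (k \<otimes> u \<oplus> v)"
  shows "P x"
  using assms(1,3)
proof (induction Us arbitrary: x)
  case Nil
  then show ?case using assms(2) by simp
next
  case (Cons u Us)
  then obtain k v where "k \<in> K" "v \<in> Span K Us" "x = k \<otimes> u \<oplus> v"
    using line_extension_mem_iff by auto
  then show ?case using Cons by auto
qed

text \<open>Dedekind's independence of characters, by induction on the number of homomorphisms.
  These are total functions with arbitrary values off \<open>E\<close>, so distinct ones are
  required to differ on \<open>E\<close>.\<close>

lemma (in field) homs_independent:
  assumes "finite S" "subring E R" "\<And>\<sigma>. \<sigma> \<in> S \<Longrightarrow> \<sigma> \<in> ring_hom (R \<lparr> carrier := E \<rparr>) R"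
    and "\<And>\<sigma> \<tau>. \<sigma> \<in> S \<Longrightarrow> \<tau> \<in> S \<Longrightarrow> \<forall>x \<in> E. \<sigma> x = \<tau> x \<Longrightarrow> \<sigma> = \<tau>"
    and "c \<in> S \<rightarrow> carrier R" "\<And>x. x \<in> E \<Longrightarrow> (\<Oplus>\<sigma>\<in>S. c \<sigma> \<otimes> \<sigma> x) = \<zero>"
  shows "\<forall>\<sigma> \<in> S. c \<sigma> = \<zero>"
  using assms(1,3-)
proof (induction S arbitrary: c rule: finite_induct)
  case empty
  show ?case by simp
next
  case (insert \<tau> S)
  have hom: "\<sigma> \<in> ring_hom (R \<lparr> carrier := E \<rparr>) R" if "\<sigma> \<in> insert \<tau> S" for \<sigma>
    using insert.prems(1) that .
  have cl: "\<sigma> x \<in> carrier R" if "\<sigma> \<in> insert \<tau> S" "x \<in> E" for \<sigma> x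
    using ring_hom_memE(1)[OF hom] that by auto
  have c: "c \<sigma> \<in> carrier R" if "\<sigma> \<in> insert \<tau> S" for \<sigma> using insert.prems(3) that by auto
  have rel: "c \<tau> \<otimes> \<tau> x \<oplus> (\<Oplus>\<sigma>\<in>S. c \<sigma> \<otimes> \<sigma> x) = \<zero>" if "x \<in> E" for x
  proof -
    have "(\<Oplus>\<sigma>\<in>insert \<tau> S. c \<sigma> \<otimes> \<sigma> x) = c \<tau> \<otimes> \<tau> x \<oplus> (\<Oplus>\<sigma>\<in>S. c \<sigma> \<otimes> \<sigma> x)"
      using insert.hyps c cl that by (intro finsum_insert) auto
    then show ?thesis using insert.prems(4)[OF that] by simp
  qed
  have zero: "c \<sigma> = \<zero>" if \<sigma>: "\<sigma> \<in> S" for \<sigma>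
  proof -
    \<comment> \<open>The relation at \<open>a \<otimes> x\<close> minus \<open>\<tau> a\<close>
      times the relation at \<open>x\<close> has no \<open>\<tau>\<close> term; its coefficients are
      \<open>c \<rho>\<close> times \<open>\<rho> a \<ominus> \<tau> a\<close>, and this factor is
      nonzero for \<open>\<rho> = \<sigma>\<close>.\<close>
    obtain a where a: "a \<in> E" "\<sigma> a \<noteq> \<tau> a"
      using insert.prems(2)[of \<sigma> \<tau>] \<sigma> insert.hyps(2) by blast
    have "\<forall>\<rho> \<in> S. c \<rho> \<otimes> (\<rho> a \<ominus> \<tau> a) = \<zero>"
    proof (rule insert.IH)
      show "\<rho> \<in> ring_hom (R \<lparr> carrier := E \<rparr>) R" if "\<rho> \<in> S" for \<rho> using hom that by auto
      show "\<rho> = \<rho>'" if "\<rho> \<in> S" "\<rho>' \<in> S" "\<forall>x \<in> E. \<rho> x = \<rho>' x" for \<rho> \<rho>'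
        using insert.prems(2)[of \<rho> \<rho>'] that by auto
      show "(\<lambda>\<rho>. c \<rho> \<otimes> (\<rho> a \<ominus> \<tau> a)) \<in> S \<rightarrow> carrier R" using c cl a by auto
      fix x assume x: "x \<in> E"
      have ax: "a \<otimes> x \<in> E" using subringE(6)[OF assms(2)] a x by auto
      have mult: "\<rho> (a \<otimes> x) = \<rho> a \<otimes> \<rho> x" if "\<rho> \<in> insert \<tau> S" for \<rho>
        using ring_hom_memE(2)[OF hom[OF that]] a x by auto
      let ?s = "\<lambda>x. \<Oplus>\<rho>\<in>S. c \<rho> \<otimes> \<rho> x"
      have s: "?s x \<in> carrier R" "?s (a \<otimes> x) \<in> carrier R" using c cl x ax by (auto intro!: finsum_closed)
      have 1: "c \<rho> \<otimes> (\<rho> a \<ominus> \<tau> a) \<otimes> \<rho> x = c \<rho> \<otimes> \<rho> (a \<otimes> x) \<oplus> \<ominus> \<tau> a \<otimes> (c \<rho> \<otimes> \<rho> x)" if "\<rho> \<in> S" for \<rho>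
      proof -
        have "c \<rho> \<in> carrier R" "\<rho> a \<in> carrier R" "\<rho> x \<in> carrier R" "\<tau> a \<in> carrier R"
          using that c cl a x by auto
        then show ?thesis using mult[of \<rho>] that by (simp add: a_minus_def r_distr l_distr l_minus r_minus m_ac)
      qed
      have "(\<Oplus>\<rho>\<in>S. c \<rho> \<otimes> (\<rho> a \<ominus> \<tau> a) \<otimes> \<rho> x) =
              (\<Oplus>\<rho>\<in>S. c \<rho> \<otimes> \<rho> (a \<otimes> x) \<oplus> \<ominus> \<tau> a \<otimes> (c \<rho> \<otimes> \<rho> x))"
        using c cl a x ax by (intro finsum_cong') (auto simp: 1 Pi_iff)
      also have "\<dots> = ?s (a \<otimes> x) \<oplus> (\<Oplus>\<rho>\<in>S. \<ominus> \<tau> a \<otimes> (c \<rho> \<otimes> \<rho> x))"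
        using c cl a x ax by (intro finsum_addf) (auto simp: Pi_iff)
      also have "(\<Oplus>\<rho>\<in>S. \<ominus> \<tau> a \<otimes> (c \<rho> \<otimes> \<rho> x)) = \<ominus> \<tau> a \<otimes> ?s x"
        using c cl a x insert.hyps by (intro finsum_rdistr[symmetric]) (auto simp: Pi_iff)
      also have "?s (a \<otimes> x) = \<ominus> (c \<tau> \<otimes> \<tau> (a \<otimes> x))"
        using rel[OF ax] c cl ax s by (intro sum_zero_eq_neg) (auto simp: a_comm)
      also have "?s x = \<ominus> (c \<tau> \<otimes> \<tau> x)"
        using rel[OF x] c cl x s by (intro sum_zero_eq_neg) (auto simp: a_comm)
      also have "\<ominus> (c \<tau> \<otimes> \<tau> (a \<otimes> x)) \<oplus> \<ominus> \<tau> a \<otimes> \<ominus> (c \<tau> \<otimes> \<tau> x) = \<zero>"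
      proof -
        have "c \<tau> \<in> carrier R" "\<tau> a \<in> carrier R" "\<tau> x \<in> carrier R" using c cl a x by auto
        then show ?thesis using mult[of \<tau>] by (simp add: l_minus r_minus m_lcomm l_neg)
      qed
      finally show "(\<Oplus>\<rho>\<in>S. c \<rho> \<otimes> (\<rho> a \<ominus> \<tau> a) \<otimes> \<rho> x) = \<zero>" .
    qed
    then have "c \<sigma> \<otimes> (\<sigma> a \<ominus> \<tau> a) = \<zero>" using \<sigma> by auto
    moreover have "\<sigma> a \<ominus> \<tau> a \<noteq> \<zero>" using a cl \<sigma> by simp
    ultimately show ?thesis using c cl \<sigma> a by (metis insertCI integral minus_closed)
  qed
  \<comment> \<open>Only the coefficient of \<open>\<tau>\<close> is left, and evaluation at
    \<open>\<one>\<close> isolates it.\<close>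
  have one: "\<one> \<in> E" "\<tau> \<one> = \<one>" using subringE(3)[OF assms(2)] ring_hom_memE(4)[OF hom] by auto
  have "(\<Oplus>\<sigma>\<in>S. c \<sigma> \<otimes> \<sigma> \<one>) = \<zero>" using zero cl one by (intro add.finprod_one_eqI) auto
  then have "c \<tau> = \<zero>" using rel[OF one(1)] c one by simp
  then show ?case using zero by auto
qed

text \<open>With more than \<open>n\<close> homomorphisms, the conditions at a basis of
  \<open>n\<close> elements have a nontrivial solution; by \<open>F\<close>-linearity the relation
  spreads to all of \<open>E\<close> and contradicts independence.\<close>

lemma (in field) card_homs_le_dimension:
  assumes F: "subfield F R" and E: "subring E R" and dim: "dimension n F E" and "F \<subseteq> E"
    and hom: "\<And>\<sigma>. \<sigma> \<in> S \<Longrightarrow> \<sigma> \<in> ring_hom (R \<lparr> carrier := E \<rparr>) R"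
    and fix_F: "\<And>\<sigma> k. \<sigma> \<in> S \<Longrightarrow> k \<in> F \<Longrightarrow> \<sigma> k = k"
    and inj: "\<And>\<sigma> \<tau>. \<sigma> \<in> S \<Longrightarrow> \<tau> \<in> S \<Longrightarrow> \<forall>x \<in> E. \<sigma> x = \<tau> x \<Longrightarrow> \<sigma> = \<tau>"
  shows "finite S" "card S \<le> n"
proof -
  \<comment> \<open>\<open>S\<close> is not yet known to be finite. The bound is proved for finite
    subsets, and an infinite \<open>S\<close> would have one with \<open>Suc n\<close>
    elements.\<close>
  have le: "card T \<le> n" if T: "T \<subseteq> S" "finite T" for T
  proof (rule ccontr)
    assume "\<not> card T \<le> n"
    obtain Us where Us: "set Us \<subseteq> carrier R" "independent F Us" "length Us = n" "Span F Us = E"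
      using exists_base[OF F dim] by auto
    have UsE: "set Us \<subseteq> E" using Span_base_incl[OF F Us(1)] Us(4) by auto
    have cl: "\<sigma> x \<in> carrier R" if "\<sigma> \<in> T" "x \<in> E" for \<sigma> x
      using ring_hom_memE(1)[OF hom] T that by auto
    have "\<exists>c \<in> T \<rightarrow> carrier R. (\<exists>\<sigma> \<in> T. c \<sigma> \<noteq> \<zero>) \<and>
            (\<forall>u \<in> set Us. (\<Oplus>\<sigma>\<in>T. c \<sigma> \<otimes> \<sigma> u) = \<zero>)"
      using \<open>\<not> card T \<le> n\<close> T cl UsE Us(3) card_length[of Us]
      by (intro exists_nontrivial_solution) auto
    then obtain c where c: "c \<in> T \<rightarrow> carrier R" "\<exists>\<sigma> \<in> T. c \<sigma> \<noteq> \<zero>"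
        "\<And>u. u \<in> set Us \<Longrightarrow> (\<Oplus>\<sigma>\<in>T. c \<sigma> \<otimes> \<sigma> u) = \<zero>" by auto
    have "x \<in> E \<and> (\<Oplus>\<sigma>\<in>T. c \<sigma> \<otimes> \<sigma> x) = \<zero>" if "x \<in> Span F Us" for x
      using that
    proof (induction rule: Span_induct)
      case zero
      have "c \<sigma> \<otimes> \<sigma> \<zero> = \<zero>" if "\<sigma> \<in> T" for \<sigma>
      proof -
        have "\<sigma> \<zero> = \<zero>" using fix_F[of \<sigma> \<zero>] subringE(2)[OF subfieldE(1)[OF F]] T that by auto
        then show ?thesis using c(1) that by (auto simp: Pi_iff)
      qed
      then have "(\<Oplus>\<sigma>\<in>T. c \<sigma> \<otimes> \<sigma> \<zero>) = \<zero>" by (intro add.finprod_one_eqI)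
      then show ?case using subringE(2)[OF E] by auto
    next
      case (step k u v)
      have mem: "k \<in> E" "u \<in> E" "v \<in> E" "k \<in> carrier R" using step UsE \<open>F \<subseteq> E\<close> subringE(1)[OF E] by auto
      then have mem': "k \<otimes> u \<in> E" "k \<otimes> u \<oplus> v \<in> E" using subringE(6,7)[OF E] by auto
      have "c \<sigma> \<otimes> \<sigma> (k \<otimes> u \<oplus> v) = k \<otimes> (c \<sigma> \<otimes> \<sigma> u) \<oplus> c \<sigma> \<otimes> \<sigma> v" if "\<sigma> \<in> T" for \<sigma>
      proof -
        have "\<sigma> (k \<otimes> u \<oplus> v) = k \<otimes> \<sigma> u \<oplus> \<sigma> v"
          using ring_hom_memE(2,3)[OF hom, of \<sigma>] mem mem' fix_F[of \<sigma> k] step T that by auto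
        then show ?thesis
          using c(1) that cl[OF that] mem by (auto simp: r_distr m_lcomm Pi_iff)
      qed
      then have "(\<Oplus>\<sigma>\<in>T. c \<sigma> \<otimes> \<sigma> (k \<otimes> u \<oplus> v)) = (\<Oplus>\<sigma>\<in>T. k \<otimes> (c \<sigma> \<otimes> \<sigma> u) \<oplus> c \<sigma> \<otimes> \<sigma> v)"
        using c(1) cl mem by (intro finsum_cong') (auto simp: Pi_iff)
      also have "\<dots> = (\<Oplus>\<sigma>\<in>T. k \<otimes> (c \<sigma> \<otimes> \<sigma> u)) \<oplus> (\<Oplus>\<sigma>\<in>T. c \<sigma> \<otimes> \<sigma> v)"
        using c(1) cl mem by (intro finsum_addf) (auto simp: Pi_iff)
      also have "(\<Oplus>\<sigma>\<in>T. k \<otimes> (c \<sigma> \<otimes> \<sigma> u)) = k \<otimes> (\<Oplus>\<sigma>\<in>T. c \<sigma> \<otimes> \<sigma> u)"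
        using c(1) cl mem T(2) by (intro finsum_rdistr[symmetric]) (auto simp: Pi_iff)
      finally show ?case using step c(3) mem mem' by simp
    qed
    then have rel: "(\<Oplus>\<sigma>\<in>T. c \<sigma> \<otimes> \<sigma> x) = \<zero>" if "x \<in> E" for x
      unfolding Us(4) using that by blast
    have "\<forall>\<sigma> \<in> T. c \<sigma> = \<zero>"
      by (rule homs_independent[OF T(2) E _ _ c(1) rel]) (use T hom inj in blast)+
    then show False using c(2) by auto
  qed
  show "finite S"
    using le infinite_arbitrarily_large[of S "Suc n"] by (metis Suc_n_not_le_n)
  then show "card S \<le> n" using le by auto
qed

text \<open>Artin's argument: a solution of minimal support of the system with matrix \<open>\<sigma> u\<^sub>j\<close>, scaled to
  have an entry 1, is fixed by \<open>A\<close>, since otherwise subtracting its image shrinks the support. The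
  assumptions on \<open>A\<close> say that it is a group, up to values outside \<open>E\<close>.\<close>

lemma (in field) independent_over_fixed_field_length_le:
  assumes E: "subfield E R" and "finite A"
    and hom: "\<And>\<sigma>. \<sigma> \<in> A \<Longrightarrow> \<sigma> \<in> ring_hom (R \<lparr> carrier := E \<rparr>) (R \<lparr> carrier := E \<rparr>)"
    and id: "\<exists>\<sigma> \<in> A. \<forall>x \<in> E. \<sigma> x = x"
    and div: "\<And>\<sigma> \<tau>. \<sigma> \<in> A \<Longrightarrow> \<tau> \<in> A \<Longrightarrow> \<exists>\<rho> \<in> A. \<forall>x \<in> E. \<sigma> x = \<tau> (\<rho> x)"
    and F: "subfield (fixed_field E A) R"
    and ind: "independent (fixed_field E A) Us" "set Us \<subseteq> E"
  shows "length Us \<le> card A"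
proof (rule ccontr)
  define m where "m = length Us"
  let ?J = "{..<m}"
  assume "\<not> length Us \<le> card A"
  then have less: "card A < card ?J" by (simp add: m_def)
  interpret E: field "R \<lparr> carrier := E \<rparr>" using subfield_iff(2)[OF E] .
  note Es = subringE[OF subfieldE(1)[OF E]]
  have U: "Us ! j \<in> E" if "j \<in> ?J" for j using ind(2) that by (auto simp: m_def)
  have cl: "\<sigma> x \<in> E" if "\<sigma> \<in> A" "x \<in> E" for \<sigma> x using ring_hom_memE(1)[OF hom] that by auto
  have hr: "ring_hom_cring (R \<lparr> carrier := E \<rparr>) (R \<lparr> carrier := E \<rparr>) \<sigma>" if "\<sigma> \<in> A" for \<sigma>
    using hom[OF that] E.is_cring by (simp add: ring_hom_cring_def ring_hom_cring_axioms_def)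
  \<comment> \<open>Coefficients must lie in \<open>E\<close>, since members of \<open>A\<close> are
    to be applied to them; the system is accordingly solved inside the field
    \<open>E\<close>.\<close>
  define P where "P c \<longleftrightarrow> c \<in> ?J \<rightarrow> E \<and> (\<exists>j \<in> ?J. c j \<noteq> \<zero>) \<and>
      (\<forall>\<sigma> \<in> A. (\<Oplus>j\<in>?J. c j \<otimes> \<sigma> (Us ! j)) = \<zero>)" for c
  have "\<exists>c. P c"
  proof -
    have "\<exists>c \<in> ?J \<rightarrow> E. (\<exists>j \<in> ?J. c j \<noteq> \<zero>) \<and>
        (\<forall>\<sigma> \<in> A. finsum (R \<lparr> carrier := E \<rparr>) (\<lambda>j. c j \<otimes> \<sigma> (Us ! j)) ?J = \<zero>)"
      using E.exists_nontrivial_solution[of A ?J "\<lambda>\<sigma> j. \<sigma> (Us ! j)"] \<open>finite A\<close> less U cl by simp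
    then obtain c where c: "c \<in> ?J \<rightarrow> E" "\<exists>j \<in> ?J. c j \<noteq> \<zero>"
       "\<And>\<sigma>. \<sigma> \<in> A \<Longrightarrow> finsum (R \<lparr> carrier := E \<rparr>) (\<lambda>j. c j \<otimes> \<sigma> (Us ! j)) ?J = \<zero>" by auto
    have "(\<Oplus>j\<in>?J. c j \<otimes> \<sigma> (Us ! j)) = \<zero>" if "\<sigma> \<in> A" for \<sigma>
      using c(3)[OF that] finsum_consistent[OF subfieldE(1)[OF E], of "\<lambda>j. c j \<otimes> \<sigma> (Us ! j)" ?J]
        c(1) U cl[OF that] Es(6) by (auto simp: Pi_iff)
    then show ?thesis using c P_def by auto
  qed
  then obtain c where c: "P c" and min: "\<And>d. P d \<Longrightarrow> card {j \<in> ?J. c j \<noteq> \<zero>} \<le> card {j \<in> ?J. d j \<noteq> \<zero>}"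
    using ex_has_least_nat[of P _ "\<lambda>c. card {j \<in> ?J. c j \<noteq> \<zero>}"] by blast
  obtain j0 where j0: "j0 \<in> ?J" "c j0 \<noteq> \<zero>" using c P_def by auto
  have cE: "c j \<in> E" "c j \<in> carrier R" if "j \<in> ?J" for j using c that Es(1) unfolding P_def by auto
  define a where "a = inv (c j0)"
  have a: "a \<in> E" "a \<in> carrier R" "a \<noteq> \<zero>" "a \<otimes> c j0 = \<one>"
    using subfield_m_inv[OF E, of "c j0"] j0 cE Es(1) unfolding a_def by auto
  define d where "d j = a \<otimes> c j" for j
  have dE: "d j \<in> E" "d j \<in> carrier R" if "j \<in> ?J" for j using a cE[OF that] Es(1,6) unfolding d_def by auto
  have drel: "(\<Oplus>j\<in>?J. d j \<otimes> \<sigma> (Us ! j)) = \<zero>" if "\<sigma> \<in> A" for \<sigma>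
  proof -
    have clR: "\<sigma> (Us ! j) \<in> carrier R" if "j \<in> ?J" for j using cl[OF \<open>\<sigma> \<in> A\<close> U[OF that]] Es(1) by auto
    have "(\<Oplus>j\<in>?J. d j \<otimes> \<sigma> (Us ! j)) = (\<Oplus>j\<in>?J. a \<otimes> (c j \<otimes> \<sigma> (Us ! j)))"
      using a cE clR by (intro finsum_cong') (auto simp: d_def m_assoc)
    also have "\<dots> = a \<otimes> (\<Oplus>j\<in>?J. c j \<otimes> \<sigma> (Us ! j))"
      using a cE clR by (intro finsum_rdistr[symmetric]) auto
    also have "\<dots> = \<zero>" using c that a unfolding P_def by auto
    finally show ?thesis .
  qed
  have supp: "d j \<noteq> \<zero> \<longleftrightarrow> c j \<noteq> \<zero>" if "j \<in> ?J" for j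
    using a cE[OF that] integral unfolding d_def by auto
  have fixed: "\<tau> (d j) = d j" if \<tau>: "\<tau> \<in> A" and j: "j \<in> ?J" for \<tau> j
  proof (rule ccontr)
    assume neq: "\<tau> (d j) \<noteq> d j"
    interpret \<tau>: ring_hom_cring "R \<lparr> carrier := E \<rparr>" "R \<lparr> carrier := E \<rparr>" \<tau> using hr[OF \<tau>] .
    have \<tau>1: "\<tau> \<one> = \<one>" "\<tau> \<zero> = \<zero>" using \<tau>.hom_one \<tau>.hom_zero by auto
    \<comment> \<open>A solution of smaller support: zeros of \<open>d\<close> stay zeros, and at
      \<open>j0\<close> the entry \<open>\<one>\<close> cancels. The factor
      \<open>\<ominus> \<one>\<close> can be pulled out of sums.\<close>
    define e where "e j = d j \<oplus> \<ominus> \<one> \<otimes> \<tau> (d j)" for j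
    have eE: "e j \<in> E" if "j \<in> ?J" for j
      using dE[OF that] cl[OF \<tau>] Es(3,5,6,7) by (simp add: e_def)
    have \<tau>d: "\<tau> (d j) \<in> carrier R" if "j \<in> ?J" for j using dE[OF that] cl[OF \<tau>] Es(1) by auto
    have "P e"
      unfolding P_def
    proof (intro conjI ballI)
      show "e \<in> ?J \<rightarrow> E" using eE by auto
      have "e j \<noteq> \<zero>"
        using neq dE[OF j] \<tau>d[OF j] unfolding e_def
        by (metis l_minus l_one one_closed minus_eq r_right_minus_eq)
      then show "\<exists>j \<in> ?J. e j \<noteq> \<zero>" using j by auto
      fix \<sigma> assume \<sigma>: "\<sigma> \<in> A"
      \<comment> \<open>As \<open>\<sigma> = \<tau> \<circ> \<rho>\<close> on \<open>E\<close>,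
        applying \<open>\<tau>\<close> to the equation of \<open>\<rho>\<close> yields the equation
        of \<open>\<sigma>\<close> with coefficients \<open>\<tau> (d j)\<close>.\<close>
      obtain \<rho> where \<rho>: "\<rho> \<in> A" "\<forall>x \<in> E. \<sigma> x = \<tau> (\<rho> x)" using div[OF \<sigma> \<tau>] by auto
      have clR: "\<sigma> (Us ! j) \<in> carrier R" if "j \<in> ?J" for j using cl[OF \<sigma> U[OF that]] Es(1) by auto
      have fE: "(\<lambda>j. d j \<otimes> \<rho> (Us ! j)) \<in> ?J \<rightarrow> E" using dE U cl[OF \<rho>(1)] Es(6) by auto
      have gE: "(\<lambda>j. \<tau> (d j) \<otimes> \<sigma> (Us ! j)) \<in> ?J \<rightarrow> E" using dE U cl[OF \<tau>] cl[OF \<sigma>] Es(6) by auto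
      have "\<zero> = \<tau> (\<Oplus>j\<in>?J. d j \<otimes> \<rho> (Us ! j))" using drel[OF \<rho>(1)] \<tau>1 by simp
      also have "\<dots> = \<tau> (finsum (R \<lparr> carrier := E \<rparr>) (\<lambda>j. d j \<otimes> \<rho> (Us ! j)) ?J)"
        using finsum_consistent[OF subfieldE(1)[OF E] fE] by simp
      also have "\<dots> = finsum (R \<lparr> carrier := E \<rparr>) (\<tau> \<circ> (\<lambda>j. d j \<otimes> \<rho> (Us ! j))) ?J"
        using fE by (intro \<tau>.hom_finsum) auto
      also have "\<dots> = finsum (R \<lparr> carrier := E \<rparr>) (\<lambda>j. \<tau> (d j) \<otimes> \<sigma> (Us ! j)) ?J"
        using gE dE U cl[OF \<rho>(1)] \<rho>(2) \<tau>.hom_mult by (intro E.finsum_cong') auto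
      also have "\<dots> = (\<Oplus>j\<in>?J. \<tau> (d j) \<otimes> \<sigma> (Us ! j))"
        using finsum_consistent[OF subfieldE(1)[OF E] gE] by simp
      finally have 1: "(\<Oplus>j\<in>?J. \<tau> (d j) \<otimes> \<sigma> (Us ! j)) = \<zero>" by simp
      have "(\<Oplus>j\<in>?J. e j \<otimes> \<sigma> (Us ! j)) =
              (\<Oplus>j\<in>?J. d j \<otimes> \<sigma> (Us ! j) \<oplus> \<ominus> \<one> \<otimes> (\<tau> (d j) \<otimes> \<sigma> (Us ! j)))"
        using dE \<tau>d clR by (intro finsum_cong') (auto simp: e_def l_distr m_assoc)
      also have "\<dots> = (\<Oplus>j\<in>?J. d j \<otimes> \<sigma> (Us ! j)) \<oplus> (\<Oplus>j\<in>?J. \<ominus> \<one> \<otimes> (\<tau> (d j) \<otimes> \<sigma> (Us ! j)))"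
        using dE \<tau>d clR by (intro finsum_addf) auto
      also have "(\<Oplus>j\<in>?J. \<ominus> \<one> \<otimes> (\<tau> (d j) \<otimes> \<sigma> (Us ! j))) = \<ominus> \<one> \<otimes> (\<Oplus>j\<in>?J. \<tau> (d j) \<otimes> \<sigma> (Us ! j))"
        using \<tau>d clR by (intro finsum_rdistr[symmetric]) auto
      finally show "(\<Oplus>j\<in>?J. e j \<otimes> \<sigma> (Us ! j)) = \<zero>" using 1 drel[OF \<sigma>] by simp
    qed
    have "{j \<in> ?J. e j \<noteq> \<zero>} \<subset> {j \<in> ?J. c j \<noteq> \<zero>}"
    proof
      have "e j = \<zero>" if "j \<in> ?J" "c j = \<zero>" for j
      proof -
        have "d j = \<zero>" using supp that by auto
        then show ?thesis using \<tau>1 by (simp add: e_def)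
      qed
      then show "{j \<in> ?J. e j \<noteq> \<zero>} \<subseteq> {j \<in> ?J. c j \<noteq> \<zero>}" by auto
      have "e j0 = \<zero>" using a(4) \<tau>1 by (simp add: e_def d_def r_neg)
      then show "{j \<in> ?J. e j \<noteq> \<zero>} \<noteq> {j \<in> ?J. c j \<noteq> \<zero>}" using j0 by auto
    qed
    then have "card {j \<in> ?J. e j \<noteq> \<zero>} < card {j \<in> ?J. c j \<noteq> \<zero>}"
      by (intro psubset_card_mono) auto
    then show False using min[OF \<open>P e\<close>] by simp
  qed
  define Ks where "Ks = map d [0..<m]"
  have Ks: "set Ks \<subseteq> fixed_field E A"
    using fixed dE by (auto simp: Ks_def fixed_field_def)
  \<comment> \<open>The equation of the identity is a linear relation of \<open>Us\<close> over the
    fixed field, nontrivial at \<open>j0\<close>.\<close>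
  obtain \<iota> where \<iota>: "\<iota> \<in> A" "\<forall>x \<in> E. \<iota> x = x" using id by auto
  have "combine Ks Us = (\<Oplus>j\<in>?J. Ks ! j \<otimes> Us ! j)"
    unfolding m_def using dE ind(2) Es(1)
    by (intro combine_eq_finsum) (auto simp: Ks_def m_def)
  also have "\<dots> = (\<Oplus>j\<in>?J. d j \<otimes> \<iota> (Us ! j))"
    using dE U U[THEN subsetD[OF Es(1)]] \<iota>(2) by (intro finsum_cong') (auto simp: Ks_def)
  finally have "combine Ks Us = \<zero>" using drel[OF \<iota>(1)] by simp
  moreover have "d j0 \<in> set (take (length Us) Ks)" using j0 by (auto simp: Ks_def m_def)
  then have "\<not> set (take (length Us) Ks) \<subseteq> {\<zero>}" using supp[OF j0(1)] j0 by auto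
  ultimately show False using non_trivial_combine_imp_dependent[OF F Ks] ind(1) by auto
qed

section \<open>Dimensions of intermediate fields\<close>

lemma (in ring) finite_dimension_over_intermediate:
  assumes K: "subfield K R" and F: "subfield F R" and "K \<subseteq> F" "F \<subseteq> E" and E: "subring E R"
    and fin: "finite_dimension K E"
  shows "finite_dimension F E"
proof -
  obtain Us where Us: "set Us \<subseteq> carrier R" "Span K Us = E" using exists_base[OF K] fin by blast
  have UsE: "set Us \<subseteq> E" using Span_base_incl[OF K Us(1)] Us(2) by auto
  have "subalgebra F E R"
    using subringE[OF E] \<open>F \<subseteq> E\<close> subring.axioms(1)[OF E]
    by (intro subalgebra.intro subalgebra_axioms.intro) auto
  then have "Span F Us \<subseteq> E" using subalgebra_Span_incl[OF F] UsE by simp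
  \<comment> \<open>A list spanning over \<open>K\<close> still spans over the larger field
    \<open>F\<close>.\<close>
  moreover have "x \<in> Span F Us" if "x \<in> Span K Us" for x
    using that
  proof (induction rule: Span_induct)
    case zero
    show ?case using Span_subgroup_props[OF F Us(1)] by simp
  next
    case (step k u v)
    then show ?case
      using Span_subgroup_props(3)[OF F Us(1)] Span_smult_closed[OF F Us(1)] Span_base_incl[OF F Us(1)] \<open>K \<subseteq> F\<close> by blast
  qed
  ultimately have "Span F Us = E" using Us(2) by blast
  then show ?thesis using Span_finite_dimension[OF F Us(1)] by simp
qed

lemma (in ring) finite_dimension_of_intermediate:
  assumes K: "subfield K R" and F: "subring F R" and "K \<subseteq> F" "F \<subseteq> E" and fin: "finite_dimension K E"
  shows "finite_dimension K F"
proof -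
  have "subalgebra K F R"
    using subringE[OF F] \<open>K \<subseteq> F\<close> subring.axioms(1)[OF F]
    by (intro subalgebra.intro subalgebra_axioms.intro) auto
  then show ?thesis using subalbegra_incl_imp_finite_dimension[OF K fin] \<open>F \<subseteq> E\<close> by simp
qed

lemma (in domain) dim_pos:
  assumes "subfield K R" "finite_dimension K E" "\<one> \<in> E"
  shows "dim K E > 0"
proof (rule ccontr)
  assume "\<not> dim K E > 0"
  then have "E = {\<zero>}"
    using finite_dimensionE[OF assms(1,2)] dimension_zero[OF assms(1)] by (simp add: over_def)
  then show False using assms(3) by simp
qed

text \<open>The list \<open>[\<one>]\<close> is independent and lies in both \<open>K\<close> and
  \<open>F\<close>, so in dimension one it spans either of them.\<close>

lemma (in ring) dim_one_iff:
  assumes K: "subfield K R" and F: "K \<subseteq> F" and fin: "finite_dimension K F" and "\<one> \<noteq> \<zero>"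
  shows "dim K F = 1 \<longleftrightarrow> F = K"
proof
  assume "F = K"
  then show "dim K F = 1" using dimI[OF K dimension_one[OF K]] by (simp add: over_def)
next
  assume "dim K F = 1"
  then have dim: "dimension 1 K F" using finite_dimensionE[OF K fin] by (simp add: over_def)
  have ind: "independent K [\<one>]" using \<open>\<one> \<noteq> \<zero>\<close> by (intro li_Cons) auto
  have one: "set [\<one>] \<subseteq> K" using subringE(3)[OF subfieldE(1)[OF K]] by simp
  have "Span K [\<one>] = K" using independent_length_eq_dimension[OF K dimension_one[OF K] ind one] by simp
  moreover have "Span K [\<one>] = F"
    using independent_length_eq_dimension[OF K dim ind order.trans[OF one F]] by simp
  ultimately show "F = K" by simp
qed

section \<open>Fixed fields and Artin's equality\<close>

lemma (in field) fixed_field_is_subfield: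
  assumes E: "subfield E R"
    and hom: "\<And>\<sigma>. \<sigma> \<in> A \<Longrightarrow> \<sigma> \<in> ring_hom (R \<lparr> carrier := E \<rparr>) (R \<lparr> carrier := E \<rparr>)"
  shows "subfield (fixed_field E A) R"
proof (rule subfieldI'[OF subringI])
  note Er = subringE[OF subfieldE(1)[OF E]]
  note h = ring_hom_memE[OF hom, simplified]
  have ring: "ring (R \<lparr> carrier := E \<rparr>)" using subring_is_ring[OF subfieldE(1)[OF E]] .
  have zero: "\<sigma> \<zero> = \<zero>" if "\<sigma> \<in> A" for \<sigma> using ring_hom_zero[OF hom[OF that] ring ring] by simp
  let ?F = "fixed_field E A"
  show "?F \<subseteq> carrier R" "\<one> \<in> ?F" using Er h by (auto simp: fixed_field_def)
  fix x assume x: "x \<in> ?F"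
  then have xE: "x \<in> E" "x \<in> carrier R" using Er by (auto simp: fixed_field_def)
  have "\<sigma> (\<ominus> x) = \<ominus> x" if \<sigma>: "\<sigma> \<in> A" for \<sigma>
  proof -
    have "\<sigma> (\<ominus> x) \<oplus> \<sigma> x = \<sigma> (\<ominus> x \<oplus> x)" using h(3)[OF \<sigma>] xE Er(5) by simp
    moreover have "\<sigma> x = x" using x \<sigma> by (simp add: fixed_field_def)
    ultimately have "\<sigma> (\<ominus> x) \<oplus> x = \<zero>" using xE zero[OF \<sigma>] by (simp add: l_neg)
    then show ?thesis using minus_equality[of "\<sigma> (\<ominus> x)" x] xE Er(1,5) h(1)[OF \<sigma>, of "\<ominus> x"] by auto
  qed
  then show "\<ominus> x \<in> ?F" using xE Er by (auto simp: fixed_field_def)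
  fix y assume y: "y \<in> ?F"
  then have yE: "y \<in> E" by (simp add: fixed_field_def)
  have "\<sigma> (x \<otimes> y) = x \<otimes> y" "\<sigma> (x \<oplus> y) = x \<oplus> y" if \<sigma>: "\<sigma> \<in> A" for \<sigma>
  proof -
    have "\<sigma> x = x" "\<sigma> y = y" using x y \<sigma> by (auto simp: fixed_field_def)
    then show "\<sigma> (x \<otimes> y) = x \<otimes> y" "\<sigma> (x \<oplus> y) = x \<oplus> y"
      using h(2,3)[OF \<sigma> xE(1) yE] by simp_all
  qed
  then show "x \<otimes> y \<in> ?F" "x \<oplus> y \<in> ?F"
    using xE yE Er(6,7) by (auto simp: fixed_field_def)
next
  note Er = subringE[OF subfieldE(1)[OF E]]
  note h = ring_hom_memE[OF hom, simplified]
  fix x assume x: "x \<in> fixed_field E A - {\<zero>}"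
  then have xE: "x \<in> E - {\<zero>}" "x \<in> carrier R" using Er by (auto simp: fixed_field_def)
  note inv = subfield_m_inv[OF E xE(1)]
  have "\<sigma> (inv x) = inv x" if \<sigma>: "\<sigma> \<in> A" for \<sigma>
  proof -
    have "\<sigma> x \<otimes> \<sigma> (inv x) = \<sigma> (x \<otimes> inv x)" 
      using h(2)[OF \<sigma>, of x "inv x"] xE(1) inv(1) by simp
    moreover have "\<sigma> x = x" using x \<sigma> by (simp add: fixed_field_def)
    ultimately have "x \<otimes> \<sigma> (inv x) = \<one>" using h(4)[OF \<sigma>] inv by simp
    then show ?thesis using comm_inv_char[of x "\<sigma> (inv x)"] xE Er(1) h(1)[OF \<sigma>, of "inv x"] inv by auto
  qed
  then show "inv x \<in> fixed_field E A" using inv by (auto simp: fixed_field_def)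
qed

text \<open>Dedekind's bound gives one inequality and Artin's the other. \<open>A\<close> is kept
  abstract because the equality is applied both to the automorphisms of \<open>L\<close> and to
  their restrictions to the separable part.\<close>

lemma (in field) card_eq_dim_fixed_field:
  assumes E: "subfield E R"
    and hom: "\<And>\<sigma>. \<sigma> \<in> A \<Longrightarrow> \<sigma> \<in> ring_hom (R \<lparr> carrier := E \<rparr>) (R \<lparr> carrier := E \<rparr>)"
    and inj: "\<And>\<sigma> \<tau>. \<sigma> \<in> A \<Longrightarrow> \<tau> \<in> A \<Longrightarrow> \<forall>x \<in> E. \<sigma> x = \<tau> x \<Longrightarrow> \<sigma> = \<tau>"
    and id: "\<exists>\<sigma> \<in> A. \<forall>x \<in> E. \<sigma> x = x"
    and div: "\<And>\<sigma> \<tau>. \<sigma> \<in> A \<Longrightarrow> \<tau> \<in> A \<Longrightarrow> \<exists>\<rho> \<in> A. \<forall>x \<in> E. \<sigma> x = \<tau> (\<rho> x)"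
    and fin: "finite_dimension (fixed_field E A) E"
  shows "finite A" "card A = dim (fixed_field E A) E"
proof -
  let ?F = "fixed_field E A"
  have F: "subfield ?F R" using fixed_field_is_subfield[OF E hom] .
  have dim: "dimension (dim ?F E) ?F E" using finite_dimensionE[OF F fin] by (simp add: over_def)
  have hom': "\<sigma> \<in> ring_hom (R \<lparr> carrier := E \<rparr>) R" if "\<sigma> \<in> A" for \<sigma>
    using hom[OF that] subfieldE(3)[OF E] by (auto simp: ring_hom_def)
  have FE: "?F \<subseteq> E" by (auto simp: fixed_field_def)
  have fixF: "\<sigma> k = k" if "\<sigma> \<in> A" "k \<in> ?F" for \<sigma> k
    using that by (auto simp: fixed_field_def)
  have le: "finite A" "card A \<le> dim ?F E"
    by (rule card_homs_le_dimension[OF F subfieldE(1)[OF E] dim FE]; (rule hom' fixF inj; assumption))+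
  show "finite A" using le(1) by blast
  obtain Us where Us: "independent ?F Us" "length Us = dim ?F E" "Span ?F Us = E" "set Us \<subseteq> carrier R"
    using exists_base[OF F dim] by blast
  then have "set Us \<subseteq> E" using Span_base_incl[OF F] by blast
  have "length Us \<le> card A"
    by (rule independent_over_fixed_field_length_le[OF E \<open>finite A\<close> _ id _ F Us(1) \<open>set Us \<subseteq> E\<close>];
        (rule hom div; assumption))
  then have "dim ?F E \<le> card A" unfolding Us(2) .
  moreover have "card A \<le> dim ?F E" using le(2) by blast
  ultimately show "card A = dim ?F E" by simp
qed

section \<open>Separable elements\<close>

lemma (in ring) subring_nat_pow_closed:
  assumes "subring E R" "x \<in> E" shows "x [^] (n::nat) \<in> E"
  using assms(2) subringE(3,6)[OF assms(1)] by (induction n) auto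

lemma (in ring) eval_eq_finsum_coeff:
  assumes "set q \<subseteq> carrier R" "y \<in> carrier R" "length q \<le> n"
  shows "eval q y = (\<Oplus>i\<in>{..<n}. coeff q i \<otimes> y [^] i)"
proof -
  have "eval q y = (\<Oplus>i\<in>{..<length q}. coeff q i \<otimes> y [^] i)"
    using assms(1)
  proof (induction q)
    case Nil
    show ?case by simp
  next
    case (Cons a q)
    have c: "coeff q i \<in> carrier R" for i using Cons.prems by (intro coeff_in_carrier) auto
    have "(\<Oplus>i\<in>{..<length (a # q)}. coeff (a # q) i \<otimes> y [^] i) =
            a \<otimes> y [^] length q \<oplus> (\<Oplus>i\<in>{..<length q}. coeff (a # q) i \<otimes> y [^] i)"
      using c Cons.prems assms(2) by (simp add: lessThan_Suc)
    also have "(\<Oplus>i\<in>{..<length q}. coeff (a # q) i \<otimes> y [^] i) = (\<Oplus>i\<in>{..<length q}. coeff q i \<otimes> y [^] i)"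
      using c assms(2) by (intro finsum_cong') auto
    finally show ?case using Cons by simp
  qed
  also have "\<dots> = (\<Oplus>i\<in>{..<n}. coeff q i \<otimes> y [^] i)"
    using assms coeff_length[of q]
    by (intro add.finprod_mono_neutral_cong_left) auto
  finally show ?thesis .
qed

text \<open>The sum is the formal derivative at \<open>y\<close>, written out by coefficients.
  Writing \<open>p\<close> as \<open>X - y\<close> times \<open>q\<close>, where \<open>q\<close>
  still vanishes at \<open>y\<close>, turns its terms into \<open>Suc i\<close> times
  \<open>a i \<ominus> a (Suc i)\<close> with
  \<open>a i = coeff q i \<otimes> y [^] i\<close>.\<close>

lemma (in domain) derivative_at_multiple_root:
  assumes p: "p \<in> carrier (poly_ring R)" and y: "y \<in> carrier R" and mult: "alg_mult p y > 1"
  shows "(\<Oplus>i\<in>{..<degree p}. [(Suc i)] \<cdot> coeff p (Suc i) \<otimes> y [^] i) = \<zero>"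
proof -
  interpret UP: domain "poly_ring R" using univ_poly_is_domain[OF carrier_is_subring] .
  let ?l = "[\<one>, \<ominus> y]"
  have l: "?l \<in> carrier (poly_ring R)"
    using y unfolding sym[OF univ_poly_carrier] polynomial_def by auto
  have "p \<noteq> []" using mult by (auto simp: alg_mult_def)
  have "?l [^]\<^bsub>poly_ring R\<^esub> (2::nat) pdivides p"
    using le_alg_mult_imp_pdivides[OF y p, of 2] mult by simp
  then obtain r where r: "r \<in> carrier (poly_ring R)" "p = ?l [^]\<^bsub>poly_ring R\<^esub> (2::nat) \<otimes>\<^bsub>poly_ring R\<^esub> r"
    unfolding pdivides_def by auto
  define q where "q = ?l \<otimes>\<^bsub>poly_ring R\<^esub> r"
  have q: "q \<in> carrier (poly_ring R)" using l r(1) by (simp add: q_def)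
  have "?l [^]\<^bsub>poly_ring R\<^esub> (2::nat) = ?l \<otimes>\<^bsub>poly_ring R\<^esub> ?l"
    using l by (simp add: numeral_2_eq_2)
  then have pq: "p = ?l \<otimes>\<^bsub>poly_ring R\<^esub> q" using r l by (simp add: q_def UP.m_assoc)
  have sets: "set q \<subseteq> carrier R" "set ?l \<subseteq> carrier R" "set p \<subseteq> carrier R" "set r \<subseteq> carrier R"
    using q l p r(1) unfolding sym[OF univ_poly_carrier] polynomial_def by auto
  have "eval q y = eval ?l y \<otimes> eval r y"
    unfolding q_def univ_poly_mult using sets y by (intro eval_poly_mult)
  also have "eval ?l y = \<zero>" using y by (simp add: r_neg)
  finally have evq: "eval q y = \<zero>" using sets y eval_in_carrier[of r y] by simp
  have "q \<noteq> []" using pq \<open>p \<noteq> []\<close> l UP.r_null unfolding univ_poly_zero by metis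
  have len: "degree p = length q"
    using poly_mult_degree_eq[OF carrier_is_subring, of ?l q] l q pq \<open>q \<noteq> []\<close>
    unfolding univ_poly_carrier univ_poly_mult by (cases q) auto
  define a where "a i = coeff q i \<otimes> y [^] i" for i
  have cq: "coeff q i \<in> carrier R" for i using sets by simp
  have a: "a i \<in> carrier R" for i using cq y by (simp add: a_def)
  have coeff: "coeff p (Suc i) = coeff q i \<oplus> \<ominus> y \<otimes> coeff q (Suc i)" for i
  proof -
    have "coeff p (Suc i) = (\<Oplus>k\<in>{..Suc i}. coeff ?l k \<otimes> coeff q (Suc i - k))"
      unfolding pq univ_poly_mult using poly_mult_coeff[OF sets(2,1)] by metis
    also have "\<dots> = (\<Oplus>k\<in>{0,1}. coeff ?l k \<otimes> coeff q (Suc i - k))"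
      using cq y by (intro add.finprod_mono_neutral_cong_right) auto
    also have "\<dots> = \<ominus> y \<otimes> coeff q (Suc i) \<oplus> coeff q i"
      using cq y by simp
    finally show ?thesis using cq y by (simp add: a_comm)
  qed
  have term_eq: "[(Suc i)] \<cdot> coeff p (Suc i) \<otimes> y [^] i = [(Suc i)] \<cdot> a i \<ominus> [(Suc i)] \<cdot> a (Suc i)" for i
  proof -
    have scalar: "[k] \<cdot> u = [k] \<cdot> \<one> \<otimes> u" if "u \<in> carrier R" for k :: nat and u
      using that by (simp add: add_pow_ldistr)
    have "[(Suc i)] \<cdot> coeff p (Suc i) \<otimes> y [^] i = [(Suc i)] \<cdot> \<one> \<otimes> (coeff p (Suc i) \<otimes> y [^] i)"
      using sets(3) y by (subst scalar) (auto simp: m_assoc)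
    also have "coeff p (Suc i) \<otimes> y [^] i = a i \<ominus> a (Suc i)"
      using cq y unfolding coeff a_def by (simp add: l_distr r_distr l_minus r_minus a_minus_def m_ac)
    also have "[(Suc i)] \<cdot> \<one> \<otimes> (a i \<ominus> a (Suc i)) = [(Suc i)] \<cdot> a i \<ominus> [(Suc i)] \<cdot> a (Suc i)"
      unfolding scalar[OF a, of "Suc i" i] scalar[OF a, of "Suc i" "Suc i"]
      using a by (simp only: a_minus_def r_distr r_minus one_closed add.nat_pow_closed a_inv_closed)
    finally show ?thesis .
  qed
  \<comment> \<open>Summation by parts. At \<open>n = degree p\<close> the boundary term vanishes
    and the remaining sum is the value of \<open>q\<close> at \<open>y\<close>.\<close>
  have "(\<Oplus>i\<in>{..<n}. [(Suc i)] \<cdot> coeff p (Suc i) \<otimes> y [^] i) = (\<Oplus>i\<in>{..<n}. a i) \<ominus> [n] \<cdot> a n" for n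
  proof (induction n)
    case 0
    show ?case using a by (simp add: a_minus_def)
  next
    case (Suc n)
    define s where "s = (\<Oplus>i\<in>{..<n}. a i)"
    have s: "s \<in> carrier R" using a by (auto simp: s_def intro!: finsum_closed)
    have "(\<Oplus>i\<in>{..<Suc n}. [(Suc i)] \<cdot> coeff p (Suc i) \<otimes> y [^] i) =
            [(Suc n)] \<cdot> coeff p (Suc n) \<otimes> y [^] n \<oplus> (\<Oplus>i\<in>{..<n}. [(Suc i)] \<cdot> coeff p (Suc i) \<otimes> y [^] i)"
      unfolding lessThan_Suc using sets(3) y by (intro finsum_insert) auto
    also have "\<dots> = ([(Suc n)] \<cdot> a n \<ominus> [(Suc n)] \<cdot> a (Suc n)) \<oplus> (s \<ominus> [n] \<cdot> a n)"
      unfolding term_eq[of n] Suc s_def ..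
    also have "\<dots> = (a n \<oplus> s) \<ominus> [(Suc n)] \<cdot> a (Suc n)"
      using a s by (simp add: a_minus_def) (simp add: a_ac r_neg2 r_neg1)
    also have "a n \<oplus> s = (\<Oplus>i\<in>{..<Suc n}. a i)"
      using a by (simp add: lessThan_Suc s_def)
    finally show ?case .
  qed
  moreover have "(\<Oplus>i\<in>{..<degree p}. a i) = \<zero>"
    using eval_eq_finsum_coeff[OF sets(1) y, of "degree p"] len evq by (simp add: a_def)
  moreover have "a (degree p) = \<zero>"
    using coeff_length[of q "degree p"] len y by (simp add: a_def)
  ultimately show ?thesis by (simp add: a_minus_def)
qed

text \<open>\<open>Irr K x\<close> is monic and irreducible, so uniqueness makes it the minimal
  polynomial of each of its roots.\<close>

lemma (in domain) Irr_eq_of_root: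
  assumes K: "subfield K R" and x: "x \<in> carrier R" "(algebraic over K) x"
    and y: "y \<in> carrier R" "eval (Irr K x) y = \<zero>"
  shows "(algebraic over K) y" "Irr K y = Irr K x"
proof -
  note I = IrrE[OF K x]
  have "Irr K x \<noteq> []" using pirreducibleE(1)[OF subfieldE(1)[OF K] I(1,2)] .
  then show alg: "(algebraic over K) y" using algebraicI[OF I(1) _ y(2)] by auto
  show "Irr K y = Irr K x"
    using minimal_polynomial_is_unique[OF K y(1) alg] IrrE[OF K y(1) alg] I y(2) by blast
qed

text \<open>\<open>Ks\<close> is a bare coefficient list that may start with zeros, as the
  coefficients of a derivative do. Its value is a linear combination of powers of \<open>y\<close>
  below the degree, and those are independent.\<close>

lemma (in domain) relation_below_degree_trivial:
  assumes K: "subfield K R" and y: "y \<in> carrier R" "(algebraic over K) y"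
    and Ks: "set Ks \<subseteq> K" "length Ks \<le> degree (Irr K y)" "eval Ks y = \<zero>"
  shows "set Ks \<subseteq> {\<zero>}"
proof -
  have "exp_base y n = map (\<lambda>i. y [^] i) (rev [length Ks..<n]) @ exp_base y (length Ks)"
    if "length Ks \<le> n" for n
    using exp_base_append[of y "length Ks" "n - length Ks"] that by simp
  note this[OF Ks(2)]
  then have "independent K (exp_base y (length Ks))"
    using exp_base_independent[OF K y] independent_split(1)[OF K] by metis
  from independent_imp_trivial_combine[OF K this Ks(1)] show ?thesis
    using combine_eq_eval[of Ks y] Ks(3) by (simp add: exp_base_def)
qed

text \<open>Coefficient lists start with the leading coefficient, so a coefficient function becomes
  one by reversal.\<close>

lemma (in ring) eval_rev_map:
  assumes "\<And>i. i < n \<Longrightarrow> g i \<in> carrier R" "y \<in> carrier R"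
  shows "eval (rev (map g [0..<n])) y = (\<Oplus>i\<in>{..<n}. g i \<otimes> y [^] i)"
proof -
  have "coeff (rev (map g [0..<n])) i = g i" if "i < n" for i
    using coeff_nth[of i "rev (map g [0..<n])"] that by (simp add: rev_nth)
  moreover have "set (rev (map g [0..<n])) \<subseteq> carrier R" using assms by auto
  ultimately show ?thesis
    using assms by (subst eval_eq_finsum_coeff[of _ y n]) (auto intro!: finsum_cong')
qed

context field
begin

lemma pow_exp_char_add:
  "exp_char p \<Longrightarrow> x \<in> carrier R \<Longrightarrow> y \<in> carrier R \<Longrightarrow> (x \<oplus> y) [^] p = x [^] p \<oplus> y [^] p"
  unfolding exp_char_def by blast

lemma pow_exp_char_inj:
  assumes "exp_char p" "x \<in> carrier R" "y \<in> carrier R" "x [^] p = y [^] p"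
  shows "x = y"
proof -
  \<comment> \<open>Additivity is applied to \<open>(x \<ominus> y) \<oplus> y\<close>, which avoids
    computing the \<open>p\<close>-th power of \<open>\<ominus> y\<close>.\<close>
  have "(x \<ominus> y) [^] p = ((x \<ominus> y) [^] p \<oplus> y [^] p) \<ominus> y [^] p"
    using assms(2,3) by (simp add: a_minus_def[of R _ "y [^] p"] a_assoc r_neg)
  also have "(x \<ominus> y) [^] p \<oplus> y [^] p = x [^] p"
    using pow_exp_char_add[OF assms(1), of "x \<ominus> y" y] assms(2,3) by (simp add: a_minus_def a_assoc l_neg)
  finally have "(x \<ominus> y) [^] p = \<zero>" using assms by (simp add: a_minus_def r_neg)
  moreover have "z = \<zero>" if "z \<in> carrier R" "z [^] (n::nat) = \<zero>" for z n
    using that by (induction n) (auto simp: integral_iff)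
  ultimately have "x \<ominus> y = \<zero>" using assms(2,3) by blast
  then show ?thesis using assms(2,3) by simp
qed

lemma pow_exp_char_pow_inj:
  assumes "exp_char p" "x \<in> carrier R" "y \<in> carrier R" "x [^] (p ^ e) = y [^] (p ^ e)"
  shows "x = y"
  using assms(2-)
proof (induction e arbitrary: x y)
  case 0
  then show ?case by simp
next
  case (Suc e)
  have "(x [^] p) [^] (p ^ e) = (y [^] p) [^] (p ^ e)"
    using Suc.prems by (simp add: nat_pow_pow)
  then have "x [^] p = y [^] p" using Suc.IH Suc.prems(1,2) nat_pow_closed by blast
  then show ?case using pow_exp_char_inj[OF assms(1)] Suc.prems(1,2) by blast
qed

text \<open>If the minimal polynomial \<open>f\<close> of \<open>x\<close> had a multiple root, its derivative would vanish, so \<open>f\<close>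
  would be a polynomial in \<open>X\<^sup>p\<close> and \<open>x\<^sup>p\<close> would have smaller degree than \<open>x\<close>.\<close>

lemma separable_elementI:
  assumes p: "exp_char p" and K: "subfield K R" and x: "x \<in> carrier R" "(algebraic over K) x"
    and mem: "x \<in> simple_extension K (x [^] p)"
  shows "separable_element K x"
proof (rule ccontr)
  assume "\<not> separable_element K x"
  then obtain y where y: "y \<in> carrier R" "alg_mult (Irr K x) y > 1"
    using x(2) unfolding separable_element_def by auto
  define f where "f = Irr K x"
  define n where "n = degree f"
  note Ks = subringE[OF subfieldE(1)[OF K]]
  have f: "f \<in> carrier (K[X])" "f \<in> carrier (poly_ring R)" "f \<noteq> []" "lead_coeff f = \<one>" "eval f x = \<zero>" "n > 0"
    using IrrE[OF K x] carrier_polynomial_shell[OF subfieldE(1)[OF K]]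
      pirreducibleE(1)[OF subfieldE(1)[OF K]] pirreducible_degree[OF K]
    unfolding f_def n_def by force+
  have fK: "coeff f i \<in> K" for i
  proof -
    have "coeff f i \<in> set f \<union> {\<zero>}" using coeff_img(3)[of f] by blast
    then show ?thesis using f(1,3) Ks(2) unfolding sym[OF univ_poly_carrier] polynomial_def by auto
  qed
  then have fR: "coeff f i \<in> carrier R" for i using Ks(1) by auto
  \<comment> \<open>The derivative vanishes at \<open>y\<close>, so minimality is needed there;
    \<open>x\<close> and \<open>y\<close> share the minimal polynomial \<open>f\<close>.\<close>
  have "eval f y = \<zero>"
    using alg_mult_gt_zero_iff_is_root[OF f(2), of y] y(2) unfolding f_def is_root_def by auto
  then have Iy: "(algebraic over K) y" "Irr K y = f"
    using Irr_eq_of_root[OF K x y(1)] by (auto simp: f_def)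
  have smult: "[i] \<cdot> k \<in> K" if "k \<in> K" for i :: nat and k
    using that Ks(2,7) by (induction i) auto
  have deriv: "[(Suc i)] \<cdot> coeff f (Suc i) = \<zero>" if "i < n" for i
  proof -
    let ?D = "rev (map (\<lambda>i. [(Suc i)] \<cdot> coeff f (Suc i)) [0..<n])"
    have "set ?D \<subseteq> K" using smult fK by (auto simp del: add.nat_pow_Suc)
    moreover have "eval ?D y = \<zero>"
      using derivative_at_multiple_root[OF f(2) y(1)] y(2) fR y(1)
      by (subst eval_rev_map) (auto simp: f_def n_def)
    ultimately have "set ?D \<subseteq> {\<zero>}"
      using relation_below_degree_trivial[OF K y(1) Iy(1)] by (simp add: Iy(2) n_def del: set_rev)
    then have "\<forall>i \<in> {0..<n}. [(Suc i)] \<cdot> coeff f (Suc i) \<in> {\<zero>}"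
      unfolding set_rev set_map image_subset_iff by simp
    then show ?thesis using that by simp
  qed
  \<comment> \<open>A nonzero coefficient at \<open>i > 0\<close> forces
    \<open>[i] \<cdot> \<one> = \<zero>\<close>, the situation that the last clause of
    \<open>exp_char\<close> addresses.\<close>
  have char: "p > 1 \<and> p dvd i" if "i > 0" "coeff f i \<noteq> \<zero>" for i
  proof -
    have "i \<le> n" using that(2) coeff_degree[of f i] unfolding n_def by linarith
    then have "[i] \<cdot> coeff f i = \<zero>" using deriv[of "i - 1"] that by (cases i) auto
    then have "[i] \<cdot> \<one> \<otimes> coeff f i = \<zero>" using fR by (simp add: add_pow_ldistr)
    then have "[i] \<cdot> \<one> = \<zero>" using that(2) fR integral by (meson add.nat_pow_closed one_closed)
    then show ?thesis using p that(1) unfolding exp_char_def by blast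
  qed
  have lead: "coeff f n = \<one>" using lead_coeff_simp[OF f(3)] f(4) unfolding n_def by metis
  \<comment> \<open>The leading coefficient excludes \<open>p = 1\<close>, that is, characteristic
    zero.\<close>
  then have p1: "p > 1" "p dvd n" using char[of n] f(6) by auto
  then obtain m where m: "n = p * m" by auto
  then have "m > 0" using f(6) by auto
  \<comment> \<open>The list \<open>?G\<close> below has \<open>m + 1\<close> entries, and for a
    contradiction this number must not exceed the degree \<open>n\<close>; here
    \<open>p \<ge> 2\<close> enters.\<close>
  then have "m + 1 \<le> 2 * m" by simp
  also have "2 * m \<le> n" unfolding m using p1(1) by (intro mult_right_mono) auto
  finally have "m + 1 \<le> n" .
  define z where "z = x [^] p"
  have z: "z \<in> carrier R" using x by (simp add: z_def)
  have zx: "z \<in> simple_extension K x"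
    unfolding z_def using simple_extension_mem[OF subfieldE(1)[OF K] x(1)]
      subring_nat_pow_closed[OF simple_extension_is_subring[OF subfieldE(1)[OF K] x(1)]] by blast
  have zalg: "(algebraic over K) z" using simple_extesion_mem_imp_algebraic[OF K x zx] .
  \<comment> \<open>By \<open>mem\<close>, \<open>x\<close> and its power \<open>z\<close> generate
    the same field, so \<open>z\<close> also has degree \<open>n\<close>.\<close>
  have "simple_extension K z = simple_extension K x"
    using simple_extension_subring_incl[OF simple_extension_is_subring[OF subfieldE(1)[OF K]]]
      simple_extension_incl[OF subfieldE(3)[OF K]] zx mem x z unfolding z_def[symmetric] by (intro equalityI) auto
  then have degz: "degree (Irr K z) = n"
    using simple_extension_dim[OF K x] simple_extension_dim[OF K z zalg] by (simp add: n_def f_def)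
  \<comment> \<open>All exponents occurring in \<open>f\<close> are multiples of \<open>p\<close>,
    so \<open>f\<close> at \<open>x\<close> is \<open>?G\<close> at \<open>z\<close>.\<close>
  let ?G = "rev (map (\<lambda>i. coeff f (p * i)) [0..<Suc m])"
  have "\<zero> = (\<Oplus>j\<in>{..<Suc n}. coeff f j \<otimes> x [^] j)"
  proof -
    have "set f \<subseteq> carrier R"
      using f(2) polynomial_incl unfolding sym[OF univ_poly_carrier] by blast
    moreover have "length f \<le> Suc n" unfolding n_def by simp
    ultimately show ?thesis using eval_eq_finsum_coeff[of f x "Suc n"] x(1) f(5) by simp
  qed
  also have "\<dots> = (\<Oplus>j\<in>(\<lambda>i. p * i) ` {..<Suc m}. coeff f j \<otimes> x [^] j)"
  proof (rule add.finprod_mono_neutral_cong_right)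
    show "(\<lambda>i. p * i) ` {..<Suc m} \<subseteq> {..<Suc n}" using m by (auto simp: less_Suc_eq_le)
    show "coeff f j \<otimes> x [^] j = \<zero>" if "j \<in> {..<Suc n} - (\<lambda>i. p * i) ` {..<Suc m}" for j
    proof -
      have "coeff f j = \<zero>"
      proof (rule ccontr)
        assume "coeff f j \<noteq> \<zero>"
        then have "p dvd j" using char[of j] by (cases "j = 0") auto
        then obtain i where "j = p * i" by auto
        then show False using that m p1 by (auto simp: less_Suc_eq_le)
      qed
      then show ?thesis using x by simp
    qed
  qed (use fR x in auto)
  also have "\<dots> = (\<Oplus>i\<in>{..<Suc m}. coeff f (p * i) \<otimes> x [^] (p * i))"
    using fR x p1 by (intro finsum_reindex) (auto simp: inj_on_def)
  also have "\<dots> = (\<Oplus>i\<in>{..<Suc m}. coeff f (p * i) \<otimes> z [^] i)"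
    using fR x by (simp add: z_def nat_pow_pow)
  also have "\<dots> = eval ?G z" using fR z by (intro eval_rev_map[symmetric]) auto
  finally have "eval ?G z = \<zero>" by (rule sym)
  moreover have "set ?G \<subseteq> K" using fK by auto
  moreover have "length ?G \<le> degree (Irr K z)" unfolding degz using \<open>m + 1 \<le> n\<close> by simp
  ultimately have "set ?G \<subseteq> {\<zero>}"
    using relation_below_degree_trivial[OF K z zalg] by blast
  moreover have "coeff f (p * m) \<in> set ?G" by auto
  ultimately show False using lead m by auto
qed

end

section \<open>Spanning lists, simple extensions and p-th powers\<close>

lemma (in ring) subfield_nat_pow_closed:
  assumes "subfield K R" "x \<in> K" shows "x [^] (n::nat) \<in> K"
  using subring_nat_pow_closed[OF subfieldE(1)[OF assms(1)] assms(2)] .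

text \<open>A dependent list could be thinned to a strictly shorter independent one with the same
  span, whose length would also have to be the dimension.\<close>

lemma (in ring) spanning_list_of_minimal_length_independent:
  assumes K: "subfield K R" and Us: "set Us \<subseteq> carrier R" and dim: "dimension (length Us) K (Span K Us)"
  shows "independent K Us"
proof (rule ccontr)
  \<comment> \<open>Both bounds are carried along: the weak one shortens the list when the head is
    redundant, the strict one when the dependence sits in the tail.\<close>
  have "\<exists>Vs. Span K Vs = Span K Ws \<and> independent K Vs \<and> length Vs \<le> length Ws \<and>
          (dependent K Ws \<longrightarrow> length Vs < length Ws)" if "set Ws \<subseteq> carrier R" for Ws
    using that
  proof (induction Ws)
    case Nil
    show ?case by (intro exI[of _ "[]"]) simp
  next
    case (Cons w Ws)
    then obtain Vs where Vs: "Span K Vs = Span K Ws" "independent K Vs" "length Vs \<le> length Ws"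
        "dependent K Ws \<Longrightarrow> length Vs < length Ws" by auto
    show ?case
    proof (cases "w \<in> Span K Ws")
      case True
      have "set (w # Ws) \<subseteq> Span K Ws"
        using True Span_base_incl[OF K, of Ws] Cons.prems by auto
      then have "Span K (w # Ws) = Span K Ws"
        using mono_Span_subset[OF K, of "w # Ws" Ws] mono_Span[OF K, of Ws w] Cons.prems by auto
      then show ?thesis using Vs by (intro exI[of _ Vs]) (auto simp del: Span.simps)
    next
      case False
      then have "independent K (w # Vs)" using Vs Cons.prems by (intro li_Cons) (auto simp del: Span.simps)
      moreover have "dependent K Ws" if "dependent K (w # Ws)"
        using that False Cons.prems li_Cons by auto
      moreover have "Span K (w # Vs) = Span K (w # Ws)" using Vs(1) by simp
      ultimately show ?thesis using Vs by (intro exI[of _ "w # Vs"]) (auto simp del: Span.simps)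
    qed
  qed
  from this[OF Us] obtain Vs where Vs: "Span K Vs = Span K Us" "independent K Vs"
      "dependent K Us \<Longrightarrow> length Vs < length Us" by auto
  assume "dependent K Us"
  then show False
    using Vs dimension_is_inj[OF K dim] dimension_independent[OF Vs(2)] by (metis less_irrefl)
qed

text \<open>The powers of \<open>z\<close> below its degree are independent in \<open>K(x)\<close>
  and numerous enough to be a basis of it.\<close>

lemma (in domain) simple_extension_eqI:
  assumes K: "subfield K R" and x: "x \<in> carrier R" "(algebraic over K) x"
    and z: "z \<in> simple_extension K x" "degree (Irr K x) \<le> degree (Irr K z)"
  shows "simple_extension K z = simple_extension K x"
proof -
  note Kr = subfieldE(1)[OF K]
  have sr: "subring (simple_extension K x) R" using simple_extension_is_subring[OF Kr x(1)] .
  have zR: "z \<in> carrier R" using z subringE(1)[OF sr] by auto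
  have zalg: "(algebraic over K) z" using simple_extesion_mem_imp_algebraic[OF K x z(1)] .
  have incl: "simple_extension K z \<subseteq> simple_extension K x"
    using simple_extension_subring_incl[OF sr] simple_extension_incl[OF subringE(1)[OF Kr] x(1)] z by auto
  let ?B = "exp_base z (degree (Irr K z))"
  have ind: "independent K ?B" using exp_base_independent[OF K zR zalg] .
  have span: "Span K ?B = simple_extension K z" using Span_exp_base[OF K zR zalg] .
  have "set ?B \<subseteq> simple_extension K x"
    using Span_base_incl[OF K exp_base_closed[OF zR]] span incl by blast
  moreover have "length ?B = degree (Irr K z)" by (simp add: exp_base_def)
  ultimately have "length ?B = degree (Irr K x)"
    using independent_length_le_dimension[OF K dimension_simple_extension[OF K x] ind] z(2) by simp
  then show ?thesis
    using independent_length_eq_dimension[OF K dimension_simple_extension[OF K x] ind]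
      \<open>set ?B \<subseteq> simple_extension K x\<close> span by simp
qed

lemma (in domain) degree_Irr_one_imp_mem:
  assumes K: "subfield K R" and x: "x \<in> carrier R" "(algebraic over K) x"
    and deg: "degree (Irr K x) = 1"
  shows "x \<in> K"
proof -
  note I = IrrE[OF K x]
  obtain a b where ab: "a \<in> K" "b \<in> K" "Irr K x = [a, b]" using degree_oneE[OF I(1) deg] by metis
  then have "b \<in> carrier R" using subfieldE(3)[OF K] by auto
  then have "x \<oplus> b = \<zero>" using I(3,4) ab x by simp
  then have "x = \<ominus> b" using sum_zero_eq_neg[OF x(1) \<open>b \<in> carrier R\<close>] by simp
  then show ?thesis using subringE(5)[OF subfieldE(1)[OF K]] ab by simp
qed

context field
begin

text \<open>Taking \<open>p\<close>-th powers is semilinear: it is additive and sends the scalars in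
  \<open>K\<close> to scalars in \<open>K\<close>.\<close>

lemma pow_mem_Span_pow:
  assumes p: "exp_char p" and K: "subfield K R" and Us: "set Us \<subseteq> carrier R" and x: "x \<in> Span K Us"
  shows "x [^] p \<in> Span K (map (\<lambda>u. u [^] p) Us)"
proof -
  let ?S = "Span K (map (\<lambda>u. u [^] p) Us)"
  have Us': "set (map (\<lambda>u. u [^] p) Us) \<subseteq> carrier R" using Us by auto
  note S = Span_subgroup_props[OF K Us'] Span_smult_closed[OF K Us'] Span_base_incl[OF K Us']
  have "x \<in> carrier R \<and> x [^] p \<in> ?S"
    using x
  proof (induction rule: Span_induct)
    case zero
    have "\<zero> [^] p = \<zero>" using p unfolding exp_char_def by (cases p) auto
    then show ?case using S(2) by simp
  next
    case (step k u v)
    have c: "k \<in> carrier R" "u \<in> carrier R" using step Us subfieldE(3)[OF K] by auto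
    have "(k \<otimes> u \<oplus> v) [^] p = k [^] p \<otimes> u [^] p \<oplus> v [^] p"
      using pow_exp_char_add[OF p] c step by (simp add: nat_pow_distrib)
    moreover have "k [^] p \<otimes> u [^] p \<in> ?S"
      using S(5) subfield_nat_pow_closed[OF K step(1)] S(6) step(2) by auto
    ultimately show ?case using S(3) step c by auto
  qed
  then show ?thesis by simp
qed

text \<open>For the ring \<open>E\<close> spanned by \<open>Us\<close>, this span is
  \<open>K\<close> together with all \<open>p\<close>-th powers of \<open>E\<close>; products stay
  inside because a product of \<open>p\<close>-th powers is again one.\<close>

lemma Span_pow_is_subring:
  assumes p: "exp_char p" and K: "subfield K R" and Us: "set Us \<subseteq> carrier R"
    and E: "subring (Span K Us) R"
  shows "subring (Span K (map (\<lambda>u. u [^] p) Us)) R"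
proof -
  define Vs where "Vs = map (\<lambda>u. u [^] p) Us"
  have Vs: "set Vs \<subseteq> carrier R" using Us by (auto simp: Vs_def)
  note S = Span_subgroup_props[OF K Vs] Span_smult_closed[OF K Vs]
  have pow: "z [^] p \<in> Span K Vs" if "z \<in> Span K Us" for z
    unfolding Vs_def using pow_mem_Span_pow[OF p K Us that] .
  \<comment> \<open>One factor is first a single \<open>p\<close>-th power; linearity in that factor
    then gives arbitrary products.\<close>
  have 1: "z [^] p \<otimes> b \<in> Span K Vs" if z: "z \<in> Span K Us" and "b \<in> Span K Vs" for z b
  proof -
    have zc: "z \<in> carrier R" using z subringE(1)[OF E] by auto
    have "b \<in> carrier R \<and> z [^] p \<otimes> b \<in> Span K Vs"
      using \<open>b \<in> Span K Vs\<close>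
    proof (induction rule: Span_induct)
      case zero
      show ?case using zc S(2) by simp
    next
      case (step k u v)
      then obtain w where w: "w \<in> set Us" "u = w [^] p" by (auto simp: Vs_def)
      have c: "k \<in> carrier R" "w \<in> carrier R" using step w Us subfieldE(3)[OF K] by auto
      have "z \<otimes> w \<in> Span K Us" using subringE(6)[OF E] z w Span_base_incl[OF K Us] by auto
      then have "z [^] p \<otimes> u \<in> Span K Vs" using pow[of "z \<otimes> w"] zc c w by (simp add: nat_pow_distrib)
      then have "k \<otimes> (z [^] p \<otimes> u) \<oplus> z [^] p \<otimes> v \<in> Span K Vs" using S(3,5) step by auto
      moreover have "z [^] p \<otimes> (k \<otimes> u \<oplus> v) = k \<otimes> (z [^] p \<otimes> u) \<oplus> z [^] p \<otimes> v"
        using zc c w step by (simp add: r_distr m_lcomm)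
      ultimately show ?case using c w step by auto
    qed
    then show ?thesis by simp
  qed
  have 2: "a \<otimes> b \<in> Span K Vs" if a: "a \<in> Span K Vs" and b: "b \<in> Span K Vs" for a b
  proof -
    have bc: "b \<in> carrier R" using b S(1) by auto
    have "a \<in> carrier R \<and> a \<otimes> b \<in> Span K Vs"
      using a
    proof (induction rule: Span_induct)
      case zero
      show ?case using bc S(2) by simp
    next
      case (step k u v)
      then obtain w where w: "w \<in> set Us" "u = w [^] p" by (auto simp: Vs_def)
      have c: "k \<in> carrier R" "w \<in> carrier R" using step w Us subfieldE(3)[OF K] by auto
      have "u \<otimes> b \<in> Span K Vs" using 1[of w b] b w Span_base_incl[OF K Us] by auto
      then have "k \<otimes> (u \<otimes> b) \<oplus> v \<otimes> b \<in> Span K Vs" using S(3,5) step by auto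
      moreover have "(k \<otimes> u \<oplus> v) \<otimes> b = k \<otimes> (u \<otimes> b) \<oplus> v \<otimes> b"
        using bc c w step by (simp add: l_distr m_assoc)
      ultimately show ?case using c w step by auto
    qed
    then show ?thesis by simp
  qed
  have "\<one> \<in> Span K Vs" using pow[OF subringE(3)[OF E]] by simp
  then show ?thesis
    unfolding Vs_def[symmetric] using S(1,3,4) 2 by (intro subringI) auto
qed

lemma subfield_imp_separable_element:
  assumes p: "exp_char p" and K: "subfield K R" and "x \<in> K"
  shows "separable_element K x"
proof -
  have x: "x \<in> carrier R" using subfieldE(3)[OF K] \<open>x \<in> K\<close> by auto
  have "K \<subseteq> simple_extension K (x [^] p)"
    using simple_extension_incl[OF subfieldE(3)[OF K], of "x [^] p"] x by auto
  then show ?thesis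
    using separable_elementI[OF p K x algebraic_self[OF subfieldE(1)[OF K] \<open>x \<in> K\<close>]] \<open>x \<in> K\<close> by auto
qed

text \<open>Choose \<open>e\<close> so that the degree of \<open>x [^] (p ^ e)\<close> is least. A
  further \<open>p\<close>-th power cannot lower the degree, so it generates the same field and the
  criterion applies.\<close>

lemma exists_separable_pow:
  assumes p: "exp_char p" and K: "subfield K R" and x: "x \<in> carrier R" "(algebraic over K) x"
  shows "\<exists>e. separable_element K (x [^] (p ^ e))"
proof -
  obtain e where e: "\<And>e'. degree (Irr K (x [^] (p ^ e))) \<le> degree (Irr K (x [^] (p ^ e')))"
    using ex_has_least_nat[of "\<lambda>_. True" _ "\<lambda>e. degree (Irr K (x [^] (p ^ e)))"] by auto
  define a where "a = x [^] (p ^ e)"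
  have aR: "a \<in> carrier R" using x by (simp add: a_def)
  have "a \<in> simple_extension K x"
    unfolding a_def using subring_nat_pow_closed[OF simple_extension_is_subring[OF subfieldE(1)[OF K] x(1)]
        simple_extension_mem[OF subfieldE(1)[OF K] x(1)]] .
  then have alg: "(algebraic over K) a" using simple_extesion_mem_imp_algebraic[OF K x] by auto
  have ap: "a [^] p \<in> simple_extension K a"
    using subring_nat_pow_closed[OF simple_extension_is_subring[OF subfieldE(1)[OF K] aR]
        simple_extension_mem[OF subfieldE(1)[OF K] aR]] .
  have "a [^] p = x [^] (p ^ Suc e)" using x by (simp add: a_def nat_pow_pow mult.commute)
  then have "degree (Irr K a) \<le> degree (Irr K (a [^] p))" using e[of "Suc e"] by (simp add: a_def)
  then have "simple_extension K (a [^] p) = simple_extension K a"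
    using simple_extension_eqI[OF K aR alg ap] by simp
  then have "separable_element K a"
    using separable_elementI[OF p K aR alg] simple_extension_mem[OF subfieldE(1)[OF K] aR] by simp
  then show ?thesis by (auto simp: a_def)
qed

end

section \<open>Separable elements inside an algebraically closed field\<close>

context algebraically_closed
begin

lemma exists_root:
  assumes "q \<in> carrier (poly_ring L)" "degree q \<ge> 1"
  shows "\<exists>y \<in> carrier L. eval q y = \<zero>"
proof -
  have "size (roots q) > 0" using roots_over_carrier[OF assms(1)] assms(2) by (simp add: splitted_def)
  then have "roots q \<noteq> {#}" by auto
  then obtain y where "y \<in># roots q" by blast
  then show ?thesis using roots_mem_iff_is_root[OF assms(1)] by (auto simp: is_root_def)
qed

text \<open>The degree is the size of the multiset of roots, which here is contained in
  \<open>{#x#}\<close>.\<close>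

lemma degree_le_one_of_unique_simple_root:
  assumes q: "q \<in> carrier (poly_ring L)" and mult: "\<And>y. y \<in> carrier L \<Longrightarrow> alg_mult q y \<le> 1"
    and uniq: "\<And>y. y \<in> carrier L \<Longrightarrow> eval q y = \<zero> \<Longrightarrow> y = x"
  shows "degree q \<le> 1"
proof -
  have "count (roots q) y \<le> count {#x#} y" for y
  proof (cases "y \<in># roots q")
    case True
    then have "y \<in> carrier L" "y = x" using uniq roots_mem_iff_is_root[OF q] by (auto simp: is_root_def)
    then show ?thesis using mult[of y] alg_mult_eq_count_roots[OF q] by simp
  next
    case False
    then show ?thesis by (simp add: not_in_iff)
  qed
  then have "roots q \<subseteq># {#x#}" by (rule mset_subset_eqI)
  then have "size (roots q) \<le> 1" using size_mset_mono by fastforce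
  then show ?thesis using roots_over_carrier[OF q] by (simp add: splitted_def)
qed

text \<open>Over \<open>M = K(x\<^sup>p)\<close> the minimal polynomial of \<open>x\<close> divides
  both \<open>X\<^sup>p - x\<^sup>p\<close>, whose only root is \<open>x\<close>, and
  \<open>Irr K x\<close>, whose roots are simple. It therefore has degree one.\<close>

lemma separable_elementD:
  assumes p: "exp_char p" and K: "subfield K L" and x: "x \<in> carrier L" and sep: "separable_element K x"
  shows "x \<in> simple_extension K (x [^] p)"
proof -
  have alg: "(algebraic over K) x" using sep by (simp add: separable_element_def)
  note Kr = subfieldE(1)[OF K]
  define z where "z = x [^] p"
  have z: "z \<in> carrier L" using x by (simp add: z_def)
  have "z \<in> simple_extension K x"
    unfolding z_def using subring_nat_pow_closed[OF simple_extension_is_subring[OF Kr x]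
        simple_extension_mem[OF Kr x]] .
  then have zalg: "(algebraic over K) z" using simple_extesion_mem_imp_algebraic[OF K x alg] by auto
  define M where "M = simple_extension K z"
  have M: "subfield M L" using simple_extension_is_subfield[OF K z] zalg by (simp add: M_def)
  have KM: "K \<subseteq> M" unfolding M_def using simple_extension_incl[OF subfieldE(3)[OF K] z] .
  have zM: "z \<in> M" unfolding M_def using simple_extension_mem[OF Kr z] .
  have algM: "(algebraic over M) x" using algebraic_mono[OF KM alg] .
  note I = IrrE[OF M x algM] and J = IrrE[OF K x alg]
  note Ms = subringE[OF subfieldE(1)[OF M]]
  have IL: "Irr M x \<in> carrier (poly_ring L)" using carrier_polynomial_shell[OF subfieldE(1)[OF M] I(1)] .
  have JL: "Irr K x \<in> carrier (poly_ring L)" using carrier_polynomial_shell[OF Kr J(1)] .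
  have Jne: "Irr K x \<noteq> []" using pirreducibleE(1)[OF Kr J(1,2)] .
  \<comment> \<open>The coefficient list of \<open>X\<^sup>p - z\<close>; for \<open>p = 1\<close>
    the block of zeros is empty.\<close>
  define h where "h = \<one> # replicate (p - 1) \<zero> @ [\<ominus> z]"
  have p0: "p > 0" using p by (simp add: exp_char_def)
  have ev: "eval h y = y [^] p \<oplus> \<ominus> z" if y: "y \<in> carrier L" for y
  proof -
    have "eval (replicate (p - 1) \<zero> @ [\<ominus> z]) y = \<ominus> z"
      using y z by (subst eval_replicate) auto
    then show ?thesis using y p0 by (simp add: h_def)
  qed
  have hM: "h \<in> carrier (M[X])"
    unfolding sym[OF univ_poly_carrier] polynomial_def h_def using zM Ms by auto
  have "Irr M x pdivides h"
    using Irr_minimal[OF M x algM hM] ev[OF x] z by (simp add: z_def r_neg)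
  then have uniq: "y = x" if "y \<in> carrier L" "eval (Irr M x) y = \<zero>" for y
  proof -
    have "eval h y = \<zero>" using pdivides_imp_root_sharing[OF IL \<open>Irr M x pdivides h\<close> that] .
    then have "y [^] p = z" using ev[OF that(1)] that z by (metis minus_equality minus_minus a_inv_closed nat_pow_closed r_neg sum_zero_eq_neg)
    then show ?thesis using pow_exp_char_inj[OF p that(1) x] by (simp add: z_def)
  qed
  have "Irr M x pdivides Irr K x"
  proof -
    have "Irr K x \<in> carrier (M[X])"
      using J(1) KM unfolding sym[OF univ_poly_carrier] polynomial_def by auto
    then show ?thesis using Irr_minimal[OF M x algM _ J(4)] by simp
  qed
  then have incl: "roots (Irr M x) \<subseteq># roots (Irr K x)"
    using pdivides_imp_roots_incl[OF IL JL Jne] by simp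
  have "alg_mult (Irr M x) y \<le> 1" if y: "y \<in> carrier L" for y
  proof -
    have "alg_mult (Irr M x) y \<le> alg_mult (Irr K x) y"
      using mset_subset_eq_count[OF incl, of y]
      by (simp add: alg_mult_eq_count_roots[OF IL] alg_mult_eq_count_roots[OF JL])
    also have "\<dots> \<le> 1" using sep y by (simp add: separable_element_def)
    finally show ?thesis .
  qed
  then have "degree (Irr M x) \<le> 1" using degree_le_one_of_unique_simple_root[OF IL _ uniq] by blast
  then have "degree (Irr M x) = 1" using pirreducible_degree[OF M I(1,2)] by simp
  then have "x \<in> M" using degree_Irr_one_imp_mem[OF M x algM] by simp
  then show ?thesis by (simp add: M_def z_def)
qed

text \<open>The span of the \<open>p\<close>-th powers is a ring containing \<open>K\<close> and
  every \<open>x\<^sup>p\<close> for a generator \<open>x\<close>, hence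
  \<open>K(x\<^sup>p)\<close>, and separability puts \<open>x\<close> itself into that
  field.\<close>

lemma Span_pow_of_separable:
  assumes p: "exp_char p" and K: "subfield K L" and xs: "set xs \<subseteq> carrier L"
    and sep: "\<And>x. x \<in> set xs \<Longrightarrow> separable_element K x"
    and Us: "set Us \<subseteq> carrier L" "Span K Us = finite_extension K xs"
  shows "Span K (map (\<lambda>u. u [^] p) Us) = finite_extension K xs"
proof
  note Kr = subfieldE(1)[OF K]
  let ?Vs = "map (\<lambda>u. u [^] p) Us"
  have Vs: "set ?Vs \<subseteq> carrier L" using Us by auto
  have E: "subring (finite_extension K xs) L" using finite_extension_is_subring[OF Kr xs] .
  have "set Us \<subseteq> finite_extension K xs" using Span_base_incl[OF K Us(1)] Us(2) by auto
  then have "set ?Vs \<subseteq> Span K Us" using subring_nat_pow_closed[OF E] Us(2) by auto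
  then show "Span K ?Vs \<subseteq> finite_extension K xs" using mono_Span_subset[OF K _ Us(1)] Us(2) by auto
  have S: "subring (Span K ?Vs) L" using Span_pow_is_subring[OF p K Us(1)] E Us(2) by simp
  have KS: "K \<subseteq> Span K ?Vs"
  proof
    fix k assume k: "k \<in> K"
    have "k \<otimes> \<one> \<in> Span K ?Vs" using Span_smult_closed[OF K Vs k subringE(3)[OF S]] .
    then show "k \<in> Span K ?Vs" using k subfieldE(3)[OF K] by (simp add: subsetD)
  qed
  have "x \<in> Span K ?Vs" if x: "x \<in> set xs" for x
  proof -
    have "x \<in> finite_extension K xs" using finite_extension_mem[OF Kr xs] x by auto
    then have "x [^] p \<in> Span K ?Vs" using pow_mem_Span_pow[OF p K Us(1)] Us(2) by simp
    then have "simple_extension K (x [^] p) \<subseteq> Span K ?Vs" using simple_extension_subring_incl[OF S KS] by simp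
    then show ?thesis using separable_elementD[OF p K _ sep[OF x]] x xs by auto
  qed
  then show "finite_extension K xs \<subseteq> Span K ?Vs"
    using finite_extension_subring_incl[OF S KS] by blast
qed

text \<open>In an extension generated by separable elements, taking \<open>p\<close>-th powers maps bases to bases, so it
  maps the independent powers of \<open>z\<close> to independent powers of \<open>z\<^sup>p\<close>; hence \<open>K(z) = K(z\<^sup>p)\<close>.\<close>

lemma finite_extension_separable:
  assumes p: "exp_char p" and K: "subfield K L" and xs: "set xs \<subseteq> carrier L"
    and sep: "\<And>x. x \<in> set xs \<Longrightarrow> separable_element K x" and zE: "z \<in> finite_extension K xs"
  shows "separable_element K z"
proof -
  note Kr = subfieldE(1)[OF K]
  define E where "E = finite_extension K xs"
  have alg: "(algebraic over K) x" if "x \<in> set xs" for x using sep[OF that] by (simp add: separable_element_def)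
  have E: "subring E L" unfolding E_def using finite_extension_is_subring[OF Kr xs] .
  have KE: "K \<subseteq> E" unfolding E_def using finite_extension_incl[OF subfieldE(3)[OF K] xs] .
  have z: "z \<in> E" "z \<in> carrier L" using zE subringE(1)[OF E] by (auto simp: E_def)
  have zalg: "(algebraic over K) z" using finite_extesion_mem_imp_algebraic[OF K xs alg zE] .
  obtain N where N: "dimension N K E"
    using finite_extension_finite_dimension(1)[OF K xs alg] by (auto simp: E_def)
  define n where "n = degree (Irr K z)"
  have pows: "set (exp_base z n) \<subseteq> E" using subring_nat_pow_closed[OF E z(1)] by (auto simp: exp_base_def)
  have ind: "independent K (exp_base z n)" unfolding n_def using exp_base_independent[OF K z(2) zalg] .
  \<comment> \<open>The powers of \<open>z\<close> form the tail of a basis, so after taking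
    \<open>p\<close>-th powers they can be split off again as independent.\<close>
  obtain Ws where Ws: "length (Ws @ exp_base z n) = N" "independent K (Ws @ exp_base z n)"
      "Span K (Ws @ exp_base z n) = E"
    using complete_base[OF K N ind pows] by auto
  define Us where "Us = Ws @ exp_base z n"
  have Us: "set Us \<subseteq> carrier L" using independent_in_carrier[OF Ws(2)] by (simp add: Us_def)
  let ?Vs = "map (\<lambda>u. u [^] p) Us"
  have "Span K ?Vs = E"
    using Span_pow_of_separable[OF p K xs sep Us] Ws(3) by (simp add: Us_def E_def)
  moreover have "length ?Vs = N" using Ws(1) by (simp add: Us_def)
  ultimately have "independent K ?Vs"
    using spanning_list_of_minimal_length_independent[OF K, of ?Vs] N Us by auto
  then have "independent K (map (\<lambda>u. u [^] p) (exp_base z n))"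
    unfolding Us_def map_append using independent_split(1)[OF K] by blast
  moreover have "map (\<lambda>u. u [^] p) (exp_base z n) = exp_base (z [^] p) n"
    using z(2) by (simp add: exp_base_def nat_pow_pow mult.commute)
  ultimately have ind': "independent K (exp_base (z [^] p) n)" by simp
  have zp: "z [^] p \<in> carrier L" using z by simp
  have szp: "subring (simple_extension K (z [^] p)) L" using simple_extension_is_subring[OF Kr zp] .
  have zp_mem: "z [^] p \<in> simple_extension K z"
    using subring_nat_pow_closed[OF simple_extension_is_subring[OF Kr z(2)] simple_extension_mem[OF Kr z(2)]] .
  have zpalg: "(algebraic over K) (z [^] p)"
    using simple_extesion_mem_imp_algebraic[OF K z(2) zalg zp_mem] .
  have "set (exp_base (z [^] p) n) \<subseteq> simple_extension K (z [^] p)"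
    using subring_nat_pow_closed[OF szp simple_extension_mem[OF Kr zp]] by (auto simp: exp_base_def)
  then have "n \<le> degree (Irr K (z [^] p))"
    using independent_length_le_dimension[OF K dimension_simple_extension[OF K zp zpalg] ind']
    by (simp add: exp_base_def)
  then have "simple_extension K (z [^] p) = simple_extension K z"
    using simple_extension_eqI[OF K z(2) zalg zp_mem] by (simp add: n_def)
  then show ?thesis
    using separable_elementI[OF p K z(2) zalg] simple_extension_mem[OF Kr z(2)] by simp
qed

text \<open>Sums, products, negatives and inverses of separable elements stay in the extension
  generated by them, all of whose elements are separable.\<close>

lemma separable_elements_subfield:
  assumes p: "exp_char p" and K: "subfield K L" and E: "subfield E L" "K \<subseteq> E"
  shows "subfield {x \<in> E. separable_element K x} L"
proof (rule subfieldI'[OF subringI])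
  let ?S = "{x \<in> E. separable_element K x}"
  note Es = subringE[OF subfieldE(1)[OF E(1)]] and Kr = subfieldE(1)[OF K]
  show "?S \<subseteq> carrier L" using Es(1) by auto
  show "\<one> \<in> ?S" using subfield_imp_separable_element[OF p K] subringE(3)[OF Kr] E(2) by auto
  have fin: "separable_element K z" if "x \<in> ?S" "y \<in> ?S" "z \<in> finite_extension K [x, y]" for x y z
    using finite_extension_separable[OF p K _ _ that(3)] that(1,2) Es(1) by auto
  have sub: "subfield (finite_extension K [x, y]) L" "x \<in> finite_extension K [x, y]" "y \<in> finite_extension K [x, y]"
    if "x \<in> ?S" "y \<in> ?S" for x y
    using finite_extension_is_subfield[OF K, of "[x, y]"] finite_extension_mem[OF Kr, of "[x, y]"] that Es(1)
    by (auto simp: separable_element_def simp del: finite_extension.simps)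
  fix x y assume xy: "x \<in> ?S" "y \<in> ?S"
  note s = subringE[OF subfieldE(1)[OF sub(1)[OF xy]]] sub(2,3)[OF xy]
  show "\<ominus> x \<in> ?S" using fin[OF xy s(5)[OF s(8)]] xy Es(5) by auto
  show "x \<otimes> y \<in> ?S" using fin[OF xy s(6)[OF s(8,9)]] xy Es(6) by auto
  show "x \<oplus> y \<in> ?S" using fin[OF xy s(7)[OF s(8,9)]] xy Es(7) by auto
next
  fix k assume k: "k \<in> {x \<in> E. separable_element K x} - {\<zero>}"
  have kc: "k \<in> carrier L" "(algebraic over K) k" using k subfieldE(3)[OF E(1)] by (auto simp: separable_element_def)
  have sub: "subfield (finite_extension K [k]) L" "k \<in> finite_extension K [k]"
    using finite_extension_is_subfield[OF K, of "[k]"] finite_extension_mem[OF subfieldE(1)[OF K], of "[k]"] kc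
    by (auto simp del: finite_extension.simps)
  then have "inv k \<in> finite_extension K [k]" using subfield_m_inv(1)[OF sub(1), of k] k by auto
  then have "separable_element K (inv k)"
    using finite_extension_separable[OF p K, of "[k]" "inv k"] k kc by (auto simp del: finite_extension.simps)
  moreover have "inv k \<in> E" using subfield_m_inv(1)[OF E(1), of k] k by auto
  ultimately show "inv k \<in> {x \<in> E. separable_element K x}" by simp
qed

text \<open>\<open>GREATEST\<close> denotes something definite because the separable elements of
  \<open>E\<close> form a subfield, which then contains every separable subextension.\<close>

lemma max_separable_subextension_eq:
  assumes K: "subfield K L" and E: "subfield E L" "K \<subseteq> E"
  shows "max_separable_subextension K E = {x \<in> E. separable_element K x}"
proof -
  obtain p where p: "exp_char p" using exists_exp_char by auto
  show ?thesis
    unfolding max_separable_subextension_def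
    using separable_elements_subfield[OF p K E] subfield_imp_separable_element[OF p K] E(2)
    by (intro Greatest_equality) (auto simp: separable_extension_def)
qed

end

section \<open>Extending embeddings\<close>

text \<open>Transporting coefficients by \<open>\<phi>\<close> and evaluating at \<open>y\<close> is
  a homomorphism on polynomials. It kills \<open>Irr F x\<close>, hence every polynomial vanishing
  at \<open>x\<close>, so it factors through evaluation at \<open>x\<close>.\<close>

lemma (in domain) extend_hom_to_simple_extension:
  assumes F: "subfield F R" and \<phi>: "\<phi> \<in> ring_hom (R \<lparr> carrier := F \<rparr>) R"
    and x: "x \<in> carrier R" "(algebraic over F) x"
    and y: "y \<in> carrier R" "eval (map \<phi> (Irr F x)) y = \<zero>"
  shows "\<exists>\<psi> \<in> ring_hom (R \<lparr> carrier := simple_extension F x \<rparr>) R. (\<forall>a \<in> F. \<psi> a = \<phi> a) \<and> \<psi> x = y"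
proof -
  note Fr = subfieldE(1)[OF F]
  interpret h: ring_hom_ring "R \<lparr> carrier := F \<rparr>" R \<phi>
    using ring_hom_ringI2[OF subring_is_ring[OF Fr] ring_axioms \<phi>] .
  interpret UP: domain "F[X]" using univ_poly_is_domain[OF Fr] .
  define \<Phi> where "\<Phi> p = eval (map \<phi> p) y" for p
  have setF: "set p \<subseteq> F" if "p \<in> carrier (F[X])" for p
    using that polynomial_incl unfolding sym[OF univ_poly_carrier] by blast
  have clF: "set (map \<phi> p) \<subseteq> carrier R" if "set p \<subseteq> F" for p
    using that ring_hom_memE(1)[OF \<phi>] by auto
  have "\<Phi> \<in> ring_hom (F[X]) R"
  proof (rule ring_hom_memI)
    fix p q assume pq: "p \<in> carrier (F[X])" "q \<in> carrier (F[X])"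
    note s = setF[OF pq(1)] setF[OF pq(2)]
    note c = clF[OF s(1)] clF[OF s(2)]
    show "\<Phi> p \<in> carrier R" unfolding \<Phi>_def using c(1) y(1) by (rule eval_in_carrier)
    have pm: "set (poly_mult p q) \<subseteq> F" "set (poly_add p q) \<subseteq> F"
      using setF[OF UP.m_closed[OF pq]] setF[OF UP.a_closed[OF pq]]
      unfolding univ_poly_mult univ_poly_add by auto
    \<comment> \<open>The transfer lemma for products speaks of normalized lists; normalizing leaves
      the value unchanged.\<close>
    have "\<Phi> (poly_mult p q) = eval (normalize (map \<phi> (poly_mult p q))) y"
      unfolding \<Phi>_def using eval_normalize[OF clF[OF pm(1)] y(1)] by simp
    also have "normalize (map \<phi> (poly_mult p q)) = poly_mult (map \<phi> p) (map \<phi> q)"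
      using h.poly_mult_hom'[of p q] s poly_mult_consistent[OF Fr] by simp
    finally show "\<Phi> (p \<otimes>\<^bsub>F[X]\<^esub> q) = \<Phi> p \<otimes> \<Phi> q"
      unfolding univ_poly_mult \<Phi>_def using eval_poly_mult[OF c y(1)] by simp
    have "\<Phi> (poly_add p q) = eval (normalize (map \<phi> (poly_add p q))) y"
      unfolding \<Phi>_def using eval_normalize[OF clF[OF pm(2)] y(1)] by simp
    also have "normalize (map \<phi> (poly_add p q)) = poly_add (map \<phi> p) (map \<phi> q)"
      using h.poly_add_hom'[of p q] s poly_add_consistent[OF Fr] by simp
    finally show "\<Phi> (p \<oplus>\<^bsub>F[X]\<^esub> q) = \<Phi> p \<oplus> \<Phi> q"
      unfolding univ_poly_add \<Phi>_def using eval_poly_add[OF c y(1)] by simp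
  next
    show "\<Phi> \<one>\<^bsub>F[X]\<^esub> = \<one>" unfolding univ_poly_one \<Phi>_def using h.hom_one y by simp
  qed
  then interpret \<Phi>: ring_hom_ring "F[X]" R \<Phi> using ring_hom_ringI2[OF UP.ring_axioms ring_axioms] by simp
  interpret ev: ring_hom_ring "F[X]" R "\<lambda>p. eval p x" using eval_ring_hom[OF Fr x(1)] .
  note I = IrrE[OF F x]
  have wd: "\<Phi> p = \<Phi> q" if p: "p \<in> carrier (F[X])" and q: "q \<in> carrier (F[X])" and eq: "eval p x = eval q x" for p q
  proof -
    let ?d = "p \<oplus>\<^bsub>F[X]\<^esub> \<ominus>\<^bsub>F[X]\<^esub> q"
    have d: "?d \<in> carrier (F[X])" using p q by simp
    have "eval ?d x = \<zero>" using p q eq eval_in_carrier[of q x] setF[OF q] subfieldE(3)[OF F] x(1)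
      by (simp add: r_neg ev.hom_closed)
    then have "Irr F x pdivides ?d" using Irr_minimal[OF F x d] by simp
    then have "Irr F x divides\<^bsub>F[X]\<^esub> ?d" using pdivides_iff_shell[OF F I(1) d] by simp
    then obtain r where r: "r \<in> carrier (F[X])" "?d = Irr F x \<otimes>\<^bsub>F[X]\<^esub> r" unfolding factor_def by auto
    have "\<Phi> ?d = \<Phi> (Irr F x) \<otimes> \<Phi> r" unfolding r(2) using I(1) r(1) by simp
    also have "\<Phi> (Irr F x) = \<zero>" using y(2) by (simp add: \<Phi>_def)
    finally have "\<Phi> ?d = \<zero>" using r(1) by simp
    moreover have "\<Phi> ?d = \<Phi> p \<ominus> \<Phi> q" using p q by (simp add: a_minus_def)
    ultimately have "\<Phi> p \<ominus> \<Phi> q = \<zero>" by simp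
    then show ?thesis using p q by simp
  qed
  \<comment> \<open>An arbitrary representing polynomial is chosen; \<open>wd\<close> makes the
    choice irrelevant.\<close>
  define \<psi> where "\<psi> a = \<Phi> (SOME p. p \<in> carrier (F[X]) \<and> eval p x = a)" for a
  have \<psi>: "\<psi> (eval p x) = \<Phi> p" if "p \<in> carrier (F[X])" for p
  proof -
    let ?q = "SOME q. q \<in> carrier (F[X]) \<and> eval q x = eval p x"
    have "?q \<in> carrier (F[X]) \<and> eval ?q x = eval p x" by (rule someI[of _ p]) (use that in simp)
    then show ?thesis unfolding \<psi>_def using wd[OF _ that] by blast
  qed
  have img: "simple_extension F x = (\<lambda>p. eval p x) ` carrier (F[X])"
    using simple_extension_as_eval_img[OF subfieldE(3)[OF F] x(1)] .
  have "\<psi> \<in> ring_hom (R \<lparr> carrier := simple_extension F x \<rparr>) R"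
  proof (rule ring_hom_memI)
    show "\<psi> \<one>\<^bsub>R \<lparr> carrier := simple_extension F x \<rparr>\<^esub> = \<one>"
      using \<psi>[of "\<one>\<^bsub>F[X]\<^esub>"] ev.hom_one by simp
    fix a b assume "a \<in> carrier (R \<lparr> carrier := simple_extension F x \<rparr>)"
      "b \<in> carrier (R \<lparr> carrier := simple_extension F x \<rparr>)"
    then obtain p q where pq: "p \<in> carrier (F[X])" "a = eval p x" "q \<in> carrier (F[X])" "b = eval q x"
      unfolding img by auto
    show "\<psi> a \<in> carrier R" using pq \<psi> by simp
    show "\<psi> (a \<otimes>\<^bsub>R \<lparr> carrier := simple_extension F x \<rparr>\<^esub> b) = \<psi> a \<otimes> \<psi> b"
      using \<psi>[of "p \<otimes>\<^bsub>F[X]\<^esub> q"] pq \<psi> by simp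
    show "\<psi> (a \<oplus>\<^bsub>R \<lparr> carrier := simple_extension F x \<rparr>\<^esub> b) = \<psi> a \<oplus> \<psi> b"
      using \<psi>[of "p \<oplus>\<^bsub>F[X]\<^esub> q"] pq \<psi> by simp
  qed
  moreover have "\<psi> a = \<phi> a" if a: "a \<in> F" for a
  proof -
    have aR: "a \<in> carrier R" "\<phi> a \<in> carrier R" using a subfieldE(3)[OF F] ring_hom_memE(1)[OF \<phi>] by auto
    have "poly_of_const a \<in> carrier (F[X])"
      using ring_hom_memE(1)[OF canonical_embedding_is_hom[OF Fr]] a by auto
    moreover have "eval (poly_of_const a) x = a" using aR x by (simp add: poly_of_const_def)
    moreover have "\<Phi> (poly_of_const a) = \<phi> a"
      using aR y h.hom_zero by (simp add: \<Phi>_def poly_of_const_def)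
    ultimately show ?thesis using \<psi> by metis
  qed
  moreover have "\<psi> x = y"
  proof -
    have "\<Phi> X = y" using h.hom_one h.hom_zero y by (simp add: \<Phi>_def var_def)
    then show ?thesis using \<psi>[OF var_closed(1)[OF Fr]] eval_var[OF x(1)] by simp
  qed
  ultimately show ?thesis by auto
qed

context algebraically_closed
begin

text \<open>Generators are adjoined one at a time; algebraic closedness supplies a root of each
  transported minimal polynomial.\<close>

lemma extend_hom_to_finite_extension:
  assumes F: "subfield F L" and \<phi>: "\<phi> \<in> ring_hom (L \<lparr> carrier := F \<rparr>) L"
    and "set xs \<subseteq> carrier L" "\<And>x. x \<in> set xs \<Longrightarrow> (algebraic over F) x"
  shows "\<exists>\<psi> \<in> ring_hom (L \<lparr> carrier := finite_extension F xs \<rparr>) L. \<forall>a \<in> F. \<psi> a = \<phi> a"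
  using assms(3,4)
proof (induction xs)
  case Nil
  show ?case using \<phi> by auto
next
  case (Cons x xs)
  define F' where "F' = finite_extension F xs"
  obtain \<psi> where \<psi>: "\<psi> \<in> ring_hom (L \<lparr> carrier := F' \<rparr>) L" "\<forall>a \<in> F. \<psi> a = \<phi> a"
    using Cons unfolding F'_def by auto
  have F': "subfield F' L" unfolding F'_def using finite_extension_is_subfield[OF F] Cons.prems by auto
  have FF': "F \<subseteq> F'" unfolding F'_def using finite_extension_incl[OF subfieldE(3)[OF F]] Cons.prems by auto
  have x: "x \<in> carrier L" "(algebraic over F') x" using Cons.prems algebraic_mono[OF FF'] by auto
  note I = IrrE[OF F' x]
  have ne: "Irr F' x \<noteq> []" using pirreducibleE(1)[OF subfieldE(1)[OF F'] I(1,2)] .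
  have "\<psi> \<one> = \<one>" using ring_hom_memE(4)[OF \<psi>(1)] by simp
  then have "lead_coeff (map \<psi> (Irr F' x)) = \<one>" using I(3) ne by (simp add: hd_map)
  moreover have "set (Irr F' x) \<subseteq> F'"
    using I(1) polynomial_incl unfolding sym[OF univ_poly_carrier] by blast
  then have "set (map \<psi> (Irr F' x)) \<subseteq> carrier L" using ring_hom_memE(1)[OF \<psi>(1)] by auto
  ultimately have "map \<psi> (Irr F' x) \<in> carrier (poly_ring L)"
    unfolding sym[OF univ_poly_carrier] polynomial_def by auto
  moreover have "degree (map \<psi> (Irr F' x)) \<ge> 1" using pirreducible_degree[OF F' I(1,2)] by simp
  ultimately obtain y where y: "y \<in> carrier L" "eval (map \<psi> (Irr F' x)) y = \<zero>"
    using exists_root by blast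
  obtain \<chi> where "\<chi> \<in> ring_hom (L \<lparr> carrier := simple_extension F' x \<rparr>) L" "\<forall>a \<in> F'. \<chi> a = \<psi> a"
    using extend_hom_to_simple_extension[OF F' \<psi>(1) x y] by auto
  then show ?case using \<psi>(2) FF' by (intro bexI[of _ \<chi>]) (auto simp: F'_def)
qed

text \<open>A list spanning \<open>E\<close> over \<open>F\<close> also generates it as an
  extension, and its members are algebraic.\<close>

lemma extend_hom:
  assumes F: "subfield F L" and E: "subring E L" "F \<subseteq> E" and fin: "finite_dimension F E"
    and \<phi>: "\<phi> \<in> ring_hom (L \<lparr> carrier := F \<rparr>) L"
  shows "\<exists>\<psi> \<in> ring_hom (L \<lparr> carrier := E \<rparr>) L. \<forall>a \<in> F. \<psi> a = \<phi> a"
proof -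
  obtain Us where Us: "set Us \<subseteq> carrier L" "Span F Us = E" using exists_base[OF F] fin by blast
  have UsE: "set Us \<subseteq> E" using Span_base_incl[OF F Us(1)] Us(2) by auto
  let ?M = "finite_extension F Us"
  have "?M \<subseteq> E" using finite_extension_subring_incl[OF E UsE] .
  have M: "subring ?M L" using finite_extension_is_subring[OF subfieldE(1)[OF F] Us(1)] .
  have FM: "F \<subseteq> ?M" using finite_extension_incl[OF subfieldE(3)[OF F] Us(1)] .
  have UM: "set Us \<subseteq> ?M" using finite_extension_mem[OF subfieldE(1)[OF F] Us(1)] .
  have "x \<in> ?M" if "x \<in> Span F Us" for x
    using that
  proof (induction rule: Span_induct)
    case zero
    show ?case using subringE(2)[OF M] .
  next
    case (step k u v)
    then show ?case using subringE(6,7)[OF M] FM UM by blast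
  qed
  then have "?M = E" using \<open>?M \<subseteq> E\<close> Us(2) by blast
  moreover have "(algebraic over F) u" if "u \<in> set Us" for u
    using finite_dimension_imp_algebraic[OF F E(1) fin] UsE that by auto
  ultimately show ?thesis using extend_hom_to_finite_extension[OF F \<phi> Us(1)] by simp
qed

end

lemma (in field) subfield_hom_inj:
  assumes "subfield E R" "\<phi> \<in> ring_hom (R \<lparr> carrier := E \<rparr>) R"
  shows "inj_on \<phi> E"
  using non_trivial_field_hom_is_inj[OF assms(2) subfield_iff(2)[OF assms(1)] field_axioms] by simp

lemma (in ring) subring_hom_pow:
  assumes E: "subring E R" and \<phi>: "\<phi> \<in> ring_hom (R \<lparr> carrier := E \<rparr>) R" and x: "x \<in> E"
  shows "\<phi> (x [^] (n::nat)) = \<phi> x [^] n"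
  using ring_hom_memE[OF \<phi>] x subring_nat_pow_closed[OF E x] by (induction n) auto

lemma (in domain) eval_hom_fixing:
  assumes E: "subfield E R" and \<phi>: "\<phi> \<in> ring_hom (R \<lparr> carrier := E \<rparr>) R"
    and K: "K \<subseteq> E" "\<forall>k \<in> K. \<phi> k = k" and p: "p \<in> carrier (K[X])" and x: "x \<in> E"
  shows "eval p (\<phi> x) = \<phi> (eval p x)"
proof -
  interpret h: ring_hom_ring "R \<lparr> carrier := E \<rparr>" R \<phi>
    using ring_hom_ringI2[OF subring_is_ring[OF subfieldE(1)[OF E]] ring_axioms \<phi>] .
  have "set p \<subseteq> K" using p polynomial_incl unfolding sym[OF univ_poly_carrier] by blast
  then have "map \<phi> p = p" "set p \<subseteq> E" using K by (auto intro: map_idI)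
  then show ?thesis using h.eval_hom'[of x p] x eval_consistent[OF subfieldE(1)[OF E]] by simp
qed

lemma (in field) subfield_hom_zero:
  assumes E: "subfield E R" and \<phi>: "\<phi> \<in> ring_hom (R \<lparr> carrier := E \<rparr>) R"
  shows "\<phi> \<zero> = \<zero>"
  using ring_hom_zero[OF \<phi> subring_is_ring[OF subfieldE(1)[OF E]] ring_axioms] by simp

text \<open>An injective self-map of the finite set of roots in \<open>E\<close> of a polynomial is a permutation.\<close>

lemma (in field) endomorphism_fixing_is_surj:
  assumes K: "subfield K R" and E: "subfield E R" "K \<subseteq> E" and alg: "\<And>x. x \<in> E \<Longrightarrow> (algebraic over K) x"
    and \<phi>: "\<phi> \<in> ring_hom (R \<lparr> carrier := E \<rparr>) R" "\<forall>k \<in> K. \<phi> k = k" and img: "\<phi> ` E \<subseteq> E"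
  shows "\<phi> ` E = E"
proof
  show "E \<subseteq> \<phi> ` E"
  proof
    fix x assume x: "x \<in> E"
    have xR: "x \<in> carrier R" using x subfieldE(3)[OF E(1)] by auto
    note I = IrrE[OF K xR alg[OF x]]
    define S where "S = {y \<in> E. eval (Irr K x) y = \<zero>}"
    have "finite {y. is_root (Irr K x) y}"
      using finite_number_of_roots carrier_polynomial_shell[OF subfieldE(1)[OF K] I(1)] by auto
    moreover have "S \<subseteq> {y. is_root (Irr K x) y}"
      using subfieldE(3)[OF E(1)] pirreducibleE(1)[OF subfieldE(1)[OF K] I(1,2)] by (auto simp: S_def is_root_def)
    ultimately have "finite S" using finite_subset by blast
    moreover have "\<phi> ` S \<subseteq> S"
      using img eval_hom_fixing[OF E(1) \<phi>(1) E(2) \<phi>(2) I(1)] subfield_hom_zero[OF E(1) \<phi>(1)] by (auto simp: S_def)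
    moreover have "inj_on \<phi> S"
      using subfield_hom_inj[OF E(1) \<phi>(1)] by (rule inj_on_subset) (auto simp: S_def)
    ultimately have "\<phi> ` S = S" by (rule endo_inj_surj)
    moreover have "x \<in> S" using x I(4) by (simp add: S_def)
    ultimately show "x \<in> \<phi> ` E" by (auto simp: S_def)
  qed
qed (rule img)

lemma (in field) restrict_mem_isos_over:
  assumes E: "subfield E R" and \<phi>: "\<phi> \<in> ring_hom (R \<lparr> carrier := E \<rparr>) R"
    and K: "K \<subseteq> E" "\<forall>k \<in> K. \<phi> k = k"
  shows "restrict \<phi> E \<in> isos_over K E (\<phi> ` E)"
proof -
  have "\<phi> \<in> ring_iso (R \<lparr> carrier := E \<rparr>) (R \<lparr> carrier := \<phi> ` E \<rparr>)"
    using ring_hom_memE[OF \<phi>] subfield_hom_inj[OF E \<phi>]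
    by (intro ring_iso_memI) (auto simp: bij_betw_def)
  then have "restrict \<phi> E \<in> ring_iso (R \<lparr> carrier := E \<rparr>) (R \<lparr> carrier := \<phi> ` E \<rparr>)"
    by (rule ring.ring_iso_restrict[OF subring_is_ring[OF subfieldE(1)[OF E]]]) simp
  then show ?thesis using K by (auto simp: isos_over_def)
qed

lemma (in ring) isos_overD:
  assumes "\<phi> \<in> isos_over K E F" "F \<subseteq> carrier R"
  shows "\<phi> \<in> ring_hom (R \<lparr> carrier := E \<rparr>) R" "\<phi> \<in> ring_hom (R \<lparr> carrier := E \<rparr>) (R \<lparr> carrier := F \<rparr>)"
    "\<phi> ` E = F" "\<forall>k \<in> K. \<phi> k = k" "\<phi> \<in> extensional E"
  using assms by (auto simp: isos_over_def ring_iso_def ring_hom_def bij_betw_def)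

lemma (in field) hom_image_is_subfield:
  assumes E: "subfield E R" and \<phi>: "\<phi> \<in> ring_hom (R \<lparr> carrier := E \<rparr>) R"
  shows "subfield (\<phi> ` E) R"
proof -
  interpret h: ring_hom_ring "R \<lparr> carrier := E \<rparr>" R \<phi>
    using ring_hom_ringI2[OF subring_is_ring[OF subfieldE(1)[OF E]] ring_axioms \<phi>] .
  show ?thesis
    using h.img_is_subfield(2)[OF field.carrier_is_subfield[OF subfield_iff(2)[OF E]] one_not_zero] by simp
qed

section \<open>Finite extensions inside an algebraically closed field\<close>

locale finite_extension_in_closure = algebraically_closed L for L (structure) +
  fixes K E
  assumes K: "subfield K L" and E: "subfield E L" and KE: "K \<subseteq> E" and fin: "finite_dimension K E"
begin

lemma alg: "x \<in> E \<Longrightarrow> (algebraic over K) x"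
  using finite_dimension_imp_algebraic[OF K subfieldE(1)[OF E] fin] .

lemma in_carrier: "x \<in> E \<Longrightarrow> x \<in> carrier L" using subfieldE(3)[OF E] by auto

text \<open>Values off \<open>E\<close> are left free, so this set serves through images and values
  on \<open>E\<close>; where embeddings are counted, they are first restricted to
  \<open>E\<close>.\<close>

definition embeddings :: "('a \<Rightarrow> 'a) set"
  where "embeddings = {\<phi> \<in> ring_hom (L \<lparr> carrier := E \<rparr>) L. \<forall>k \<in> K. \<phi> k = k}"

lemma embedding_root:
  assumes "\<phi> \<in> embeddings" "x \<in> E" "p \<in> carrier (K[X])" "eval p x = \<zero>"
  shows "eval p (\<phi> x) = \<zero>"
  using assms eval_hom_fixing[OF E _ KE, of \<phi> p x] subfield_hom_zero[OF E, of \<phi>] by (simp add: embeddings_def)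

lemma embedding_in_carrier: "\<phi> \<in> embeddings \<Longrightarrow> x \<in> E \<Longrightarrow> \<phi> x \<in> carrier L"
  unfolding embeddings_def using ring_hom_memE(1)[of \<phi> "L \<lparr> carrier := E \<rparr>" L x] by simp

lemma embedding_surj: "\<phi> \<in> embeddings \<Longrightarrow> \<phi> ` E \<subseteq> E \<Longrightarrow> \<phi> ` E = E"
  unfolding embeddings_def using endomorphism_fixing_is_surj[OF K E KE alg, of \<phi>] by simp

lemma restrict_embedding_mem_auts: "\<phi> \<in> embeddings \<Longrightarrow> \<phi> ` E \<subseteq> E \<Longrightarrow> restrict \<phi> E \<in> auts_over K E"
  using restrict_mem_isos_over[OF E _ KE, of \<phi>] embedding_surj[of \<phi>]
  unfolding auts_over_def embeddings_def by simp

lemma auts_subset_embeddings: "auts_over K E \<subseteq> embeddings"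
  unfolding auts_over_def embeddings_def using isos_overD(1,4)[of _ K E E] subfieldE(3)[OF E] by auto

text \<open>The conjugate \<open>y\<close> is prescribed on \<open>K(x)\<close>, and finite
  dimension over \<open>K(x)\<close> allows the extension to \<open>E\<close>.\<close>

lemma exists_embedding:
  assumes x: "x \<in> E" and y: "y \<in> carrier L" "eval (Irr K x) y = \<zero>"
  shows "\<exists>\<phi> \<in> embeddings. \<phi> x = y"
proof -
  note xL = in_carrier[OF x] alg[OF x]
  have id: "id \<in> ring_hom (L \<lparr> carrier := K \<rparr>) L"
    using subfieldE(3)[OF K] by (auto simp: ring_hom_def)
  let ?M = "simple_extension K x"
  obtain \<psi> where \<psi>: "\<psi> \<in> ring_hom (L \<lparr> carrier := ?M \<rparr>) L" "\<forall>a \<in> K. \<psi> a = a" "\<psi> x = y"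
    using extend_hom_to_simple_extension[OF K id xL y(1)] y(2) by auto
  have M: "subfield ?M L" using simple_extension_is_subfield[OF K xL(1)] xL(2) by simp
  have ME: "?M \<subseteq> E" using simple_extension_subring_incl[OF subfieldE(1)[OF E] KE x] .
  have KM: "K \<subseteq> ?M" using simple_extension_incl[OF subfieldE(3)[OF K] xL(1)] .
  have "finite_dimension ?M E"
    using finite_dimension_over_intermediate[OF K M KM ME subfieldE(1)[OF E] fin] .
  from extend_hom[OF M subfieldE(1)[OF E] ME this \<psi>(1)] obtain \<phi>
    where "\<phi> \<in> ring_hom (L \<lparr> carrier := E \<rparr>) L" "\<forall>a \<in> ?M. \<phi> a = \<psi> a" by auto
  then show ?thesis
    using \<psi>(2,3) KM simple_extension_mem[OF subfieldE(1)[OF K] xL(1)]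
    by (intro bexI[of _ \<phi>]) (auto simp: embeddings_def)
qed

text \<open>The conjugate \<open>\<phi> x\<close> is a root of \<open>Irr K x\<close>, which splits
  over \<open>E\<close>; its minimal polynomial over \<open>E\<close> is an irreducible factor of
  that and so linear.\<close>

lemma normal_imp_embedding_into:
  assumes normal: "normal_extension K E" and \<phi>: "\<phi> \<in> embeddings"
  shows "\<phi> ` E \<subseteq> E"
proof
  fix y assume "y \<in> \<phi> ` E"
  then obtain x where x: "x \<in> E" "y = \<phi> x" by auto
  interpret F: field "L \<lparr> carrier := E \<rparr>" using subfield_iff(2)[OF E] .
  note Er = subfieldE(1)[OF E]
  note poly = univ_poly_consistent[OF Er]
  note xL = in_carrier[OF x(1)] alg[OF x(1)]
  note I = IrrE[OF K xL]
  have yL: "y \<in> carrier L" using embedding_in_carrier[OF \<phi> x(1)] x(2) by simp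
  have y0: "eval (Irr K x) y = \<zero>" using embedding_root[OF \<phi> x(1) I(1,4)] x(2) by simp
  have splitted: "F.splitted (Irr K x)"
    using normal I(1,2,4) x(1) unfolding normal_extension_def by blast
  have p: "Irr K x \<in> carrier (E[X])" "Irr K x \<noteq> []"
    using I(1) KE pirreducibleE(1)[OF subfieldE(1)[OF K] I(1,2)]
    unfolding sym[OF univ_poly_carrier] polynomial_def by auto
  have yalg: "(algebraic over E) y" using algebraicI[OF p y0] .
  note J = IrrE[OF E yL yalg]
  have "Irr E y pdivides Irr K x" using Irr_minimal[OF E yL yalg p(1) y0] .
  then have "Irr E y pdivides\<^bsub>L \<lparr> carrier := E \<rparr>\<^esub> Irr K x"
    using pdivides_iff_shell[OF E J(1) p(1)] by (simp add: pdivides_def poly)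
  then have "degree (Irr E y) = 1"
    using F.splitted_imp_trivial_factors[of "Irr K x" "Irr E y"] p splitted J(1,2) by (simp add: poly)
  then show "y \<in> E" using degree_Irr_one_imp_mem[OF E yL yalg] by simp
qed

text \<open>All roots of \<open>p\<close> are conjugates of its root \<open>x\<close>, hence values
  of embeddings and members of \<open>E\<close>. Each irreducible factor over \<open>E\<close> then
  has a root in \<open>E\<close> and is linear.\<close>

lemma embeddings_into_imp_normal:
  assumes into: "\<And>\<phi>. \<phi> \<in> embeddings \<Longrightarrow> \<phi> ` E \<subseteq> E"
  shows "normal_extension K E"
  unfolding normal_extension_def
proof (intro conjI ballI impI)
  fix p assume p: "p \<in> carrier (K[X])" "pirreducible K p" and "\<exists>x \<in> E. eval p x = \<zero>"
  then obtain x where x: "x \<in> E" "eval p x = \<zero>" by auto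
  interpret F: field "L \<lparr> carrier := E \<rparr>" using subfield_iff(2)[OF E] .
  note Er = subfieldE(1)[OF E] and Kr = subfieldE(1)[OF K]
  note poly = univ_poly_consistent[OF Er]
  note xL = in_carrier[OF x(1)] alg[OF x(1)]
  note I = IrrE[OF K xL]
  have pE: "p \<in> carrier (E[X])"
    using p(1) KE unfolding sym[OF univ_poly_carrier] polynomial_def by auto
  \<comment> \<open>Irreducibility of \<open>p\<close> makes it an associate of
    \<open>Irr K x\<close>, so that both have the same roots.\<close>
  have "Irr K x pdivides p" using Irr_minimal[OF K xL p(1) x(2)] .
  then have "Irr K x \<in> Units (K[X]) \<or> Irr K x \<sim>\<^bsub>K[X]\<^esub> p"
    using divides_pirreducible_condition[OF p(2) I(1)] pdivides_iff_shell[OF K I(1) p(1)] by simp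
  then have "p pdivides Irr K x"
    using pirreducibleE(2)[OF Kr I(1,2)] pdivides_iff_shell[OF K p(1) I(1)] unfolding associated_def by auto
  have roots_in: "y \<in> E" if y: "y \<in> carrier L" "eval p y = \<zero>" for y
  proof -
    have "eval (Irr K x) y = \<zero>"
      using pdivides_imp_root_sharing[OF carrier_polynomial_shell[OF Kr p(1)] \<open>p pdivides Irr K x\<close> y] .
    then obtain \<phi> where "\<phi> \<in> embeddings" "\<phi> x = y" using exists_embedding[OF x(1) y(1)] by auto
    then show ?thesis using into x(1) by auto
  qed
  show "F.splitted p"
  proof (rule F.trivial_factors_imp_splitted)
    show "p \<in> carrier (poly_ring (L \<lparr> carrier := E \<rparr>))" using pE by (simp add: poly)
    fix q assume q: "q \<in> carrier (poly_ring (L \<lparr> carrier := E \<rparr>))"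
      "pirreducible\<^bsub>L \<lparr> carrier := E \<rparr>\<^esub> (carrier (L \<lparr> carrier := E \<rparr>)) q"
      "q pdivides\<^bsub>L \<lparr> carrier := E \<rparr>\<^esub> p"
    then have qE: "q \<in> carrier (E[X])" "pirreducible E q" by (simp_all add: poly)
    have qL: "q \<in> carrier (poly_ring L)" using carrier_polynomial_shell[OF Er qE(1)] .
    have qp: "q pdivides p" using q(3) pdivides_iff_shell[OF E qE(1) pE] by (simp add: pdivides_def poly)
    obtain y where y: "y \<in> carrier L" "eval q y = \<zero>"
      using exists_root[OF qL pirreducible_degree[OF E qE]] by blast
    have "y \<in> E" using roots_in[OF y(1) pdivides_imp_root_sharing[OF qL qp y]] .
    then have "F.is_root q y"
      using y(2) pirreducibleE(1)[OF Er qE] eval_consistent[OF Er] by (simp add: F.is_root_def)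
    then have "F.roots q \<noteq> {#}" using F.roots_mem_iff_is_root[OF q(1)] by auto
    then have "degree q = 1" using F.pirreducible_roots[OF q(1,2)] by blast
    then show "degree q \<le> 1" by simp
  qed
qed (rule alg)

lemma normal_iff: "normal_extension K E \<longleftrightarrow> (\<forall>\<phi> \<in> embeddings. \<phi> ` E \<subseteq> E)"
  using normal_imp_embedding_into embeddings_into_imp_normal by blast

text \<open>The subfields isomorphic to \<open>E\<close> over \<open>K\<close> are the images of
  embeddings, and \<open>E\<close> is one of them; an embedding into \<open>E\<close> is already
  onto.\<close>

lemma normal_iff_s_count: "normal_extension K E \<longleftrightarrow> s_count K E = 1"
proof -
  let ?T = "{E'. subfield E' L \<and> K \<subseteq> E' \<and> isos_over K E E' \<noteq> {}}"
  have img: "\<phi> ` E \<in> ?T" if "\<phi> \<in> embeddings" for \<phi>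
  proof -
    have \<phi>: "\<phi> \<in> ring_hom (L \<lparr> carrier := E \<rparr>) L" "\<forall>k \<in> K. \<phi> k = k"
      using that by (auto simp: embeddings_def)
    have "k \<in> \<phi> ` E" if "k \<in> K" for k using \<phi>(2) KE that by (metis imageI subsetD)
    then show ?thesis using hom_image_is_subfield[OF E \<phi>(1)] restrict_mem_isos_over[OF E \<phi>(1) KE \<phi>(2)] by auto
  qed
  have id: "(\<lambda>x. x) \<in> embeddings" using subfieldE(3)[OF E] by (auto simp: embeddings_def ring_hom_def)
  then have ET: "E \<in> ?T" using img[of "\<lambda>x. x"] by simp
  show ?thesis
  proof
    assume normal: "normal_extension K E"
    have "E' = E" if E': "E' \<in> ?T" for E'
    proof -
      obtain \<phi> where "\<phi> \<in> isos_over K E E'" "E' \<subseteq> carrier L" using E' subfieldE(3)[of E' L] by blast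
      then have "\<phi> \<in> embeddings" "\<phi> ` E = E'" using isos_overD[of \<phi> K E E'] by (auto simp: embeddings_def)
      then show ?thesis using embedding_surj normal_imp_embedding_into[OF normal] by blast
    qed
    then have "?T = {E}" using ET by blast
    then show "s_count K E = 1" by (simp add: s_count_def)
  next
    assume "s_count K E = 1"
    \<comment> \<open>Infinite sets have \<open>card\<close> zero, so the value 1 does give a
      singleton.\<close>
    then obtain E0 where E0: "?T = {E0}" unfolding s_count_def using card_1_singletonE by blast
    have "\<phi> ` E = E" if "\<phi> \<in> embeddings" for \<phi> using img[OF that] ET unfolding E0 by blast
    then show "normal_extension K E" unfolding normal_iff by blast
  qed
qed

end

section \<open>Automorphisms, fixed field and separable part\<close>

context finite_extension_in_closure
begin

lemma auts_hom:
  fixes \<sigma> :: "'a \<Rightarrow> 'a"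
  assumes "\<sigma> \<in> auts_over K E"
  shows "\<sigma> \<in> ring_hom (L \<lparr> carrier := E \<rparr>) (L \<lparr> carrier := E \<rparr>)" "\<sigma> ` E = E"
    "\<forall>k \<in> K. \<sigma> k = k" "\<sigma> \<in> extensional E"
  using isos_overD(2-5)[of \<sigma> K E E] assms subfieldE(3)[OF E] unfolding auts_over_def by auto

lemma auts_eqI:
  fixes \<sigma> \<tau> :: "'a \<Rightarrow> 'a"
  assumes "\<sigma> \<in> auts_over K E" "\<tau> \<in> auts_over K E" "\<forall>x \<in> E. \<sigma> x = \<tau> x"
  shows "\<sigma> = \<tau>"
  using extensionalityI[OF auts_hom(4)[OF assms(1)] auts_hom(4)[OF assms(2)]] assms(3) by blast

lemma auts_id: "\<exists>\<sigma> \<in> auts_over K E. \<forall>x \<in> E. \<sigma> x = x"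
proof
  have "(\<lambda>x. x) \<in> embeddings" using subfieldE(3)[OF E] by (auto simp: embeddings_def ring_hom_def)
  then show "restrict (\<lambda>x. x) E \<in> auts_over K E" by (rule restrict_embedding_mem_auts) simp
qed simp

text \<open>The witness is the inverse of \<open>\<tau>\<close> on \<open>E\<close> after
  \<open>\<sigma>\<close>, cut down to \<open>E\<close> to be extensional. This quotient is the form
  in which Artin's argument uses the group property.\<close>

lemma auts_div:
  fixes \<sigma> \<tau> :: "'a \<Rightarrow> 'a"
  assumes \<sigma>: "\<sigma> \<in> auts_over K E" and \<tau>: "\<tau> \<in> auts_over K E"
  shows "\<exists>\<rho> \<in> auts_over K E. \<forall>x \<in> E. \<sigma> x = \<tau> (\<rho> x)"
proof -
  let ?E = "L \<lparr> carrier := E \<rparr>"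
  have iso: "\<sigma> \<in> ring_iso ?E ?E" "\<tau> \<in> ring_iso ?E ?E" using assms by (auto simp: auts_over_def isos_over_def)
  define \<tau>' where "\<tau>' = inv_into E \<tau>"
  have "\<tau>' \<in> ring_iso ?E ?E"
    using ring_iso_set_sym[OF subring_is_ring[OF subfieldE(1)[OF E]] iso(2)] by (simp add: \<tau>'_def)
  then have "\<tau>' \<circ> \<sigma> \<in> ring_iso ?E ?E" by (rule ring_iso_set_trans[OF iso(1)])
  then have hom: "\<tau>' \<circ> \<sigma> \<in> ring_hom ?E ?E" by (simp add: ring_iso_def)
  have inj: "inj_on \<tau> E" using iso(2) by (simp add: ring_iso_def bij_betw_def)
  have "\<tau>' (\<sigma> k) = k" if k: "k \<in> K" for k
  proof -
    have "\<sigma> k = \<tau> k" using auts_hom(3)[OF \<sigma>] auts_hom(3)[OF \<tau>] k by simp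
    then show ?thesis using inv_into_f_f[OF inj] k KE by (auto simp: \<tau>'_def)
  qed
  then have emb: "\<tau>' \<circ> \<sigma> \<in> embeddings"
    using hom subfieldE(3)[OF E] by (auto simp: embeddings_def ring_hom_def)
  have "(\<tau>' \<circ> \<sigma>) ` E \<subseteq> E" using ring_hom_memE(1)[OF hom] by auto
  then have "restrict (\<tau>' \<circ> \<sigma>) E \<in> auts_over K E" using restrict_embedding_mem_auts[OF emb] by simp
  moreover have "\<sigma> x = \<tau> (restrict (\<tau>' \<circ> \<sigma>) E x)" if x: "x \<in> E" for x
  proof -
    have "\<sigma> x \<in> \<tau> ` E" using auts_hom(2)[OF \<sigma>] auts_hom(2)[OF \<tau>] x by blast
    then show ?thesis using f_inv_into_f[of "\<sigma> x" \<tau> E] x by (simp add: \<tau>'_def)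
  qed
  ultimately show ?thesis by blast
qed

text \<open>\<open>fixed_part\<close> and \<open>sep_part\<close> are \<open>L\<^sup>A\<close> and
  \<open>L\<^sub>S\<close> of the overview, and their intersection is \<open>T\<close>.\<close>

abbreviation fixed_part where "fixed_part \<equiv> fixed_field E (auts_over K E)"
abbreviation sep_part where "sep_part \<equiv> {x \<in> E. separable_element K x}"

lemma fixed_part_subfield: "subfield fixed_part L" "K \<subseteq> fixed_part" "fixed_part \<subseteq> E"
  using fixed_field_is_subfield[OF E auts_hom(1)] auts_hom(3) KE by (auto simp: fixed_field_def)

lemma sep_part_subfield: "subfield sep_part L" "K \<subseteq> sep_part" "sep_part \<subseteq> E"
proof -
  obtain p where p: "exp_char p" using exists_exp_char by auto
  show "subfield sep_part L" "K \<subseteq> sep_part" "sep_part \<subseteq> E"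
    using separable_elements_subfield[OF p K E KE] subfield_imp_separable_element[OF p K] KE by auto
qed

lemma finite_dimension_subextensions:
  assumes "subfield F L" "K \<subseteq> F" "F \<subseteq> E"
  shows "finite_dimension K F" "finite_dimension F E"
  using finite_dimension_over_intermediate[OF K assms subfieldE(1)[OF E] fin]
    finite_dimension_of_intermediate[OF K subfieldE(1)[OF assms(1)] assms(2,3) fin] by auto

lemma card_auts: "finite (auts_over K E)" "card (auts_over K E) = dim fixed_part E"
  using card_eq_dim_fixed_field[OF E auts_hom(1) auts_eqI auts_id auts_div] finite_dimension_subextensions(2)[OF fixed_part_subfield]
  by blast+

lemma exists_pow_mem_sep_part:
  assumes "exp_char p" "x \<in> E"
  shows "\<exists>e. x [^] (p ^ e) \<in> sep_part"
  using exists_separable_pow[OF assms(1) K in_carrier[OF assms(2)] alg[OF assms(2)]]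
    subring_nat_pow_closed[OF subfieldE(1)[OF E] assms(2)] by blast

text \<open>Separability depends only on the minimal polynomial, which conjugates share.\<close>

lemma embedding_separable:
  assumes "\<phi> \<in> embeddings" "x \<in> sep_part"
  shows "separable_element K (\<phi> x)"
proof -
  have x: "x \<in> E" "x \<in> carrier L" using assms(2) in_carrier by auto
  note I = IrrE[OF K x(2) alg[OF x(1)]]
  note r = Irr_eq_of_root[OF K x(2) alg[OF x(1)] embedding_in_carrier[OF assms(1) x(1)]
      embedding_root[OF assms(1) x(1) I(1,4)]]
  show ?thesis using assms(2) r by (simp add: separable_element_def)
qed

text \<open>Equality at some \<open>x [^] (p ^ e)\<close> descends to \<open>x\<close> because
  taking \<open>p\<close>-th powers is injective.\<close>

lemma embeddings_eq_of_eq_on_sep_part: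
  assumes "\<phi> \<in> embeddings" "\<psi> \<in> embeddings" "\<forall>x \<in> sep_part. \<phi> x = \<psi> x" "x \<in> E"
  shows "\<phi> x = \<psi> x"
proof -
  obtain p where p: "exp_char p" using exists_exp_char by auto
  obtain e where "x [^] (p ^ e) \<in> sep_part" using exists_pow_mem_sep_part[OF p assms(4)] by auto
  then have "\<phi> (x [^] (p ^ e)) = \<psi> (x [^] (p ^ e))" using assms(3) by blast
  then have "\<phi> x [^] (p ^ e) = \<psi> x [^] (p ^ e)"
    using subring_hom_pow[OF subfieldE(1)[OF E] _ assms(4)] assms(1,2) by (simp add: embeddings_def)
  then show ?thesis
    using pow_exp_char_pow_inj[OF p] embedding_in_carrier assms(1,2,4) by blast
qed

text \<open>Restriction to the separable closure of \<open>K\<close> in \<open>E\<close> loses no automorphism, so Artin's theorem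
  applies to it as well.\<close>

lemma card_auts_eq_dim_sep_part: "card (auts_over K E) = dim (sep_part \<inter> fixed_part) sep_part"
proof -
  let ?r = "\<lambda>\<sigma>. restrict \<sigma> sep_part"
  define B where "B = ?r ` auts_over K E"
  have inj: "\<sigma> = \<tau>" if "\<sigma> \<in> auts_over K E" "\<tau> \<in> auts_over K E" "\<forall>x \<in> sep_part. \<sigma> x = \<tau> x" for \<sigma> \<tau>
    using auts_eqI[OF that(1,2)] embeddings_eq_of_eq_on_sep_part[of \<sigma> \<tau>] auts_subset_embeddings that by blast
  have "inj_on ?r (auts_over K E)"
  proof (intro inj_onI inj)
    fix \<sigma> \<tau> :: "'a \<Rightarrow> 'a"
    assume eq: "?r \<sigma> = ?r \<tau>"
    show "\<forall>x \<in> sep_part. \<sigma> x = \<tau> x"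
    proof
      fix x assume "x \<in> sep_part"
      show "\<sigma> x = \<tau> x"
        using fun_cong[OF eq, of x] unfolding restrict_apply'[OF \<open>x \<in> sep_part\<close>] .
    qed
  qed
  then have card: "card B = card (auts_over K E)" unfolding B_def by (rule card_image)
  have maps: "\<sigma> x \<in> sep_part" if "\<sigma> \<in> auts_over K E" "x \<in> sep_part" for \<sigma> x
    using embedding_separable[of \<sigma> x] auts_subset_embeddings auts_hom(2)[of \<sigma>] that by blast
  have hom: "\<sigma> \<in> ring_hom (L \<lparr> carrier := sep_part \<rparr>) (L \<lparr> carrier := sep_part \<rparr>)" if "\<sigma> \<in> B" for \<sigma>
  proof -
    obtain \<tau> where \<tau>: "\<tau> \<in> auts_over K E" "\<sigma> = ?r \<tau>" using \<open>\<sigma> \<in> B\<close> by (auto simp: B_def)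
    note h = ring_hom_memE[OF auts_hom(1)[OF \<tau>(1)], simplified]
    note s = subringE(3,6,7)[OF subfieldE(1)[OF sep_part_subfield(1)]]
    show ?thesis
      unfolding \<tau>(2) by (rule ring_hom_memI) (use h maps[OF \<tau>(1)] s in auto)
  qed
  \<comment> \<open>Restriction does not change the action on \<open>sep_part\<close>, so the fixed
    field is \<open>T\<close>.\<close>
  have fixed: "fixed_field sep_part B = sep_part \<inter> fixed_part"
    by (auto simp: fixed_field_def B_def)
  have "subfield (fixed_field sep_part B) L"
    by (rule fixed_field_is_subfield[OF sep_part_subfield(1)]) (rule hom)
  then have T: "subfield (sep_part \<inter> fixed_part) L" unfolding fixed .
  have fin: "finite_dimension (sep_part \<inter> fixed_part) sep_part"
    using finite_dimension_over_intermediate[OF K T _ _ subfieldE(1)[OF sep_part_subfield(1)]] sep_part_subfield(2) fixed_part_subfield(2)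
      finite_dimension_subextensions(1)[OF sep_part_subfield] by blast
  have "card B = dim (fixed_field sep_part B) sep_part"
  proof (rule card_eq_dim_fixed_field(2)[OF sep_part_subfield(1) hom])
    show "\<sigma> = \<tau>" if "\<sigma> \<in> B" "\<tau> \<in> B" "\<forall>x \<in> sep_part. \<sigma> x = \<tau> x" for \<sigma> \<tau>
      using that extensionalityI[of \<sigma> sep_part \<tau>] by (auto simp: B_def)
    show "\<exists>\<sigma> \<in> B. \<forall>x \<in> sep_part. \<sigma> x = x" using auts_id by (auto simp: B_def)
    show "\<exists>\<rho> \<in> B. \<forall>x \<in> sep_part. \<sigma> x = \<tau> (\<rho> x)" if "\<sigma> \<in> B" "\<tau> \<in> B" for \<sigma> \<tau>
    proof -
      obtain s t where st: "s \<in> auts_over K E" "\<sigma> = ?r s" "t \<in> auts_over K E" "\<tau> = ?r t"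
        using \<open>\<sigma> \<in> B\<close> \<open>\<tau> \<in> B\<close> by (auto simp: B_def)
      obtain r where r: "r \<in> auts_over K E" "\<forall>x \<in> E. s x = t (r x)" using auts_div[OF st(1,3)] by auto
      have "\<sigma> x = \<tau> (?r r x)" if "x \<in> sep_part" for x
        using r(2) maps[OF r(1) that] that unfolding st by simp
      then show ?thesis using r(1) unfolding B_def by blast
    qed
    show "finite_dimension (fixed_field sep_part B) sep_part" unfolding fixed by (rule fin)
  qed
  then show ?thesis unfolding card fixed .
qed

lemma sep_part_Int_fixed_part_subfield: "subfield (sep_part \<inter> fixed_part) L" "K \<subseteq> sep_part \<inter> fixed_part"
proof -
  have "subring (sep_part \<inter> fixed_part) L" using subring_inter subfieldE(1) sep_part_subfield(1) fixed_part_subfield(1) by blast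
  then show "subfield (sep_part \<inter> fixed_part) L"
    using subfield_m_inv(1)[OF sep_part_subfield(1)] subfield_m_inv(1)[OF fixed_part_subfield(1)] by (intro subfieldI') blast+
  show "K \<subseteq> sep_part \<inter> fixed_part" using sep_part_subfield(2) fixed_part_subfield(2) by blast
qed

text \<open>The left side equals \<open>[L\<^sub>S : T]\<close>, and
  \<open>[L\<^sub>S : K] = [T : K] [L\<^sub>S : T]\<close>; cancelling the positive factor leaves
  \<open>[T : K] = 1\<close>.\<close>

lemma r_count_eq_iff: "r_count K E = dim K sep_part \<longleftrightarrow> sep_part \<inter> fixed_part = K"
proof -
  let ?T = "sep_part \<inter> fixed_part"
  have finT: "finite_dimension K ?T" using finite_dimension_subextensions(1)[OF sep_part_Int_fixed_part_subfield] fixed_part_subfield(3) by blast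
  have finES: "finite_dimension ?T sep_part"
    using finite_dimension_over_intermediate[OF K sep_part_Int_fixed_part_subfield(1,2) _ subfieldE(1)[OF sep_part_subfield(1)]]
      finite_dimension_subextensions(1)[OF sep_part_subfield] by blast
  have "dim K sep_part = dim K ?T * dim ?T sep_part"
    using telescopic_base_dim(2)[OF K sep_part_Int_fixed_part_subfield(1) finT finES] by (simp add: over_def)
  moreover have "dim ?T sep_part > 0"
    using dim_pos[OF sep_part_Int_fixed_part_subfield(1) finES subringE(3)[OF subfieldE(1)[OF sep_part_subfield(1)]]] .
  ultimately have "r_count K E = dim K sep_part \<longleftrightarrow> dim K ?T = 1"
    unfolding r_count_def card_auts_eq_dim_sep_part by auto
  then show ?thesis using dim_one_iff[OF K sep_part_Int_fixed_part_subfield(2) finT one_not_zero] by simp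
qed

lemma purely_inseparable_iff: "purely_inseparable_extension K fixed_part \<longleftrightarrow> sep_part \<inter> fixed_part = K"
proof
  assume "purely_inseparable_extension K fixed_part"
  then have "sep_part \<inter> fixed_part \<subseteq> K" by (auto simp: purely_inseparable_extension_def)
  then show "sep_part \<inter> fixed_part = K" using sep_part_Int_fixed_part_subfield(2) by blast
next
  assume "sep_part \<inter> fixed_part = K"
  then have "\<not> separable_element K x" if "x \<in> fixed_part - K" for x using that fixed_part_subfield(3) by blast
  then show "purely_inseparable_extension K fixed_part"
    using alg fixed_part_subfield(3) by (auto simp: purely_inseparable_extension_def)
qed

lemma normal_imp_sep_part_Int_fixed_part:
  assumes normal: "normal_extension K E"
  shows "sep_part \<inter> fixed_part = K"
proof
  show "sep_part \<inter> fixed_part \<subseteq> K"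
  proof
    fix x assume x: "x \<in> sep_part \<inter> fixed_part"
    then have xE: "x \<in> E" "x \<in> carrier L" "separable_element K x" using in_carrier by auto
    note I = IrrE[OF K xE(2) alg[OF xE(1)]]
    note IL = carrier_polynomial_shell[OF subfieldE(1)[OF K] I(1)]
    \<comment> \<open>Each root of \<open>Irr K x\<close> is the image of \<open>x\<close> under an
      embedding; by normality this restricts to an automorphism, which fixes
      \<open>x\<close>.\<close>
    have uniq: "y = x" if y: "y \<in> carrier L" "eval (Irr K x) y = \<zero>" for y
    proof -
      obtain \<phi> where \<phi>: "\<phi> \<in> embeddings" "\<phi> x = y" using exists_embedding[OF xE(1) y] by auto
      have "restrict \<phi> E \<in> auts_over K E"
        using restrict_embedding_mem_auts[OF \<phi>(1) normal_imp_embedding_into[OF normal \<phi>(1)]] .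
      then have "restrict \<phi> E x = x" using x by (auto simp: fixed_field_def)
      then show ?thesis using \<phi>(2) xE(1) by simp
    qed
    have "degree (Irr K x) \<le> 1"
      using degree_le_one_of_unique_simple_root[OF IL _ uniq] xE(3) by (simp add: separable_element_def)
    then have "degree (Irr K x) = 1" using pirreducible_degree[OF K I(1,2)] by simp
    then show "x \<in> K" using degree_Irr_one_imp_mem[OF K xE(2) alg[OF xE(1)]] by simp
  qed
qed (rule sep_part_Int_fixed_part_subfield(2))

text \<open>Every embedding fixes the fixed field, and by Artin's theorem the automorphisms already
  exhaust the number of embeddings that Dedekind's lemma allows over it.\<close>

lemma sep_part_Int_fixed_part_imp_normal:
  assumes eq: "sep_part \<inter> fixed_part = K"
  shows "normal_extension K E"
proof (rule embeddings_into_imp_normal)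
  fix \<phi> assume \<phi>: "\<phi> \<in> embeddings"
  obtain p where p: "exp_char p" using exists_exp_char by auto
  have \<phi>h: "\<phi> \<in> ring_hom (L \<lparr> carrier := E \<rparr>) L" "\<forall>k \<in> K. \<phi> k = k" using \<phi> by (auto simp: embeddings_def)
  \<comment> \<open>Some \<open>p\<close>-power of \<open>x\<close> lies in \<open>T = K\<close> and
    is fixed by \<open>\<phi>\<close>; injectivity of \<open>p\<close>-powers brings this back to
    \<open>x\<close>.\<close>
  have fix_FF: "\<phi> x = x" if x: "x \<in> fixed_part" for x
  proof -
    have xE: "x \<in> E" "x \<in> carrier L" using x fixed_part_subfield(3) in_carrier by auto
    obtain e where "x [^] (p ^ e) \<in> sep_part" using exists_pow_mem_sep_part[OF p xE(1)] by auto
    then have "x [^] (p ^ e) \<in> K"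
      using subfield_nat_pow_closed[OF fixed_part_subfield(1) x] eq by blast
    then have "\<phi> x [^] (p ^ e) = x [^] (p ^ e)"
      using subring_hom_pow[OF subfieldE(1)[OF E] \<phi>h(1) xE(1)] \<phi>h(2) by metis
    then show ?thesis using pow_exp_char_pow_inj[OF p embedding_in_carrier[OF \<phi> xE(1)] xE(2)] by simp
  qed
  define S where "S = insert (restrict \<phi> E) (auts_over K E)"
  have dim: "dimension (dim fixed_part E) fixed_part E"
    using finite_dimensionE[OF fixed_part_subfield(1) finite_dimension_subextensions(2)[OF fixed_part_subfield]] by (simp add: over_def)
  have "card S \<le> dim fixed_part E"
  proof (rule card_homs_le_dimension(2)[OF fixed_part_subfield(1) subfieldE(1)[OF E] dim fixed_part_subfield(3)])
    show "\<sigma> \<in> ring_hom (L \<lparr> carrier := E \<rparr>) L" if "\<sigma> \<in> S" for \<sigma>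
    proof (cases "\<sigma> \<in> auts_over K E")
      case True
      then show ?thesis using auts_subset_embeddings by (auto simp: embeddings_def)
    next
      case False
      then have "\<sigma> = restrict \<phi> E" using that by (simp add: S_def)
      then show ?thesis
        using ring.ring_hom_restrict[OF subring_is_ring[OF subfieldE(1)[OF E]] \<phi>h(1), of "restrict \<phi> E"] by simp
    qed
    show "\<sigma> k = k" if "\<sigma> \<in> S" "k \<in> fixed_part" for \<sigma> k
      using that fix_FF[OF that(2)] fixed_part_subfield(3) by (auto simp: S_def fixed_field_def)
    show "\<sigma> = \<tau>" if "\<sigma> \<in> S" "\<tau> \<in> S" "\<forall>x \<in> E. \<sigma> x = \<tau> x" for \<sigma> \<tau>
      using that auts_hom(4) extensionalityI[of \<sigma> E \<tau>] by (auto simp: S_def)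
  qed
  \<comment> \<open>Otherwise \<open>S\<close> would have one element more than
    \<open>auts_over K E\<close>, whose cardinality already equals the bound.\<close>
  then have "restrict \<phi> E \<in> auts_over K E"
    using card_auts unfolding S_def by (metis card_insert_disjoint Suc_n_not_le_n)
  then show "\<phi> ` E \<subseteq> E" using auts_hom(2)[of "restrict \<phi> E"] by auto
qed

lemma normal_iff_sep_part_Int_fixed_part: "normal_extension K E \<longleftrightarrow> sep_part \<inter> fixed_part = K"
  using normal_imp_sep_part_Int_fixed_part sep_part_Int_fixed_part_imp_normal by blast

lemma normal_iff_r_count: "normal_extension K E \<longleftrightarrow> r_count K E = dim K sep_part"
  using normal_iff_sep_part_Int_fixed_part r_count_eq_iff by simp

lemma dim_tower_sep_part: "dim K E = dim K sep_part * dim sep_part E" "dim sep_part E > 0" "dim K sep_part > 0"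
  using telescopic_base_dim(2)[OF K sep_part_subfield(1) finite_dimension_subextensions[OF sep_part_subfield]]
    dim_pos[OF sep_part_subfield(1) finite_dimension_subextensions(2)[OF sep_part_subfield] subringE(3)[OF subfieldE(1)[OF E]]]
    dim_pos[OF K finite_dimension_subextensions(1)[OF sep_part_subfield] subringE(3)[OF subfieldE(1)[OF sep_part_subfield(1)]]]
  by (simp_all add: over_def)

lemma dim_tower_fixed_part: "dim K E = dim K fixed_part * r_count K E" "r_count K E > 0"
  using telescopic_base_dim(2)[OF K fixed_part_subfield(1) finite_dimension_subextensions[OF fixed_part_subfield]]
    dim_pos[OF fixed_part_subfield(1) finite_dimension_subextensions(2)[OF fixed_part_subfield] subringE(3)[OF subfieldE(1)[OF E]]]
  by (simp_all add: over_def r_count_def card_auts(2))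

end

theorem corollary2p8p1:
  fixes \<Omega> :: "('a, 'b) ring_scheme" and K L L\<^sub>S L\<^sub>A :: "'a set" and A :: "('a \<Rightarrow> 'a) set"
  assumes closure: "algebraic_closure \<Omega> K"
    and L: "subfield L \<Omega>" "K \<subseteq> L" "ring.finite_dimension \<Omega> K L"
    and L\<^sub>S: "L\<^sub>S = ring.max_separable_subextension \<Omega> K L"
    and A: "A = ring.auts_over \<Omega> K L"
    and L\<^sub>A: "L\<^sub>A = fixed_field L A"
  shows "(ring.normal_extension \<Omega> K L \<longleftrightarrow> ring.s_count \<Omega> K L = 1) \<and>
         (ring.normal_extension \<Omega> K L \<longleftrightarrow> ring.r_count \<Omega> K L = ring.dim \<Omega> K L\<^sub>S) \<and>
         (ring.normal_extension \<Omega> K L \<longleftrightarrow> ring.l_count \<Omega> K L = ring.dim \<Omega> K L) \<and>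
         (ring.normal_extension \<Omega> K L \<longleftrightarrow> ring.dim \<Omega> L\<^sub>S L = ring.dim \<Omega> K L\<^sub>A) \<and>
         (ring.normal_extension \<Omega> K L \<longleftrightarrow> ring.purely_inseparable_extension \<Omega> K L\<^sub>A)"
proof -
  interpret algebraic_closure \<Omega> K by (rule closure)
  interpret finite_extension_in_closure \<Omega> K L
    by (intro finite_extension_in_closure.intro finite_extension_in_closure_axioms.intro
        algebraically_closed_axioms subfield_axioms L)
  have LS: "L\<^sub>S = sep_part" unfolding L\<^sub>S using max_separable_subextension_eq[OF subfield_axioms L(1,2)] .
  have LA: "L\<^sub>A = fixed_part" unfolding L\<^sub>A A ..
  note r = normal_iff_r_count
  \<comment> \<open>Both sides carry the factor \<open>[L : L\<^sub>S]\<close>, which is positive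
    and cancels.\<close>
  have l: "l_count K L = dim K L \<longleftrightarrow> r_count K L = dim K sep_part"
    unfolding l_count_def LS[unfolded L\<^sub>S] dim_tower_sep_part(1) using dim_tower_sep_part(2) by (simp add: mult.commute)
  have e: "dim sep_part L = dim K fixed_part \<longleftrightarrow> r_count K L = dim K sep_part"
  proof -
    \<comment> \<open>The two towers give
      \<open>[L\<^sup>A : K] |A| = [L\<^sub>S : K] [L : L\<^sub>S]\<close>; with
      \<open>[L : L\<^sub>S]\<close> and \<open>[L\<^sub>S : K]\<close> positive, equality of one
      pair of factors forces equality of the other.\<close>
    have "d = a \<longleftrightarrow> c = b" if "a * c = b * d" "d > 0" "b > 0" for a b c d :: nat
      using that by (auto simp: mult.commute)
    from this[OF _ dim_tower_sep_part(2,3)] show ?thesis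
      using dim_tower_sep_part(1) dim_tower_fixed_part(1) by metis
  qed
  show ?thesis
    unfolding LS LA
    by (intro conjI, fact normal_iff_s_count, fact r,
        unfold l e, fact r, fact r, unfold purely_inseparable_iff, fact normal_iff_sep_part_Int_fixed_part)
qed

end
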